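(* Let $\alpha: G \to \mathrm{Aut}(A)$ be an action of a discrete group $G$ on a unital $C^*$-algebra $A$, and let $\psi: G \to A^+$ be a normalized $\alpha$-negative definite function. Then there exist a Hilbert $A$-module $X$, an $\alpha$-equivariant action $u$ of $G$ on $X$ and a symmetric one-cocycle $c: G \to X$ (w.r.t. $u$) such that $$\psi(g) = \langle c(g), c(g)\rangle$$ for all $g \in G$. Moreover, the $A$-submodule of $X$ generated by $\{c(g) \mid g\in G\}$ is dense in $X$. Finally, if $\psi$ takes values in $Z(A)^+$, then $c$ is also central.
   Context: Notation: $A_{\mathrm{sa}}$, $A^+$, $Z(A)$ denote the self-adjoint part, the positive cone and the center of $A$; $Z(A)^+ = Z(A)\cap A^+$; $e$ is the identity of $G$. A Hilbert $A$-module is a right Hilbert $C^*$-module over $A$ (with $A$-valued inner product linear in the second variable). A function $\psi: G\to A$ is $\alpha$-negative definite if $\alpha_g(\psi(g^{-1})) = \psi(g)^*$ for all $g\in G$ and, for any $n\in\mathbb{N}$, $g_1,\dots,g_n\in G$ and $b_1,\dots,b_n\in A$ with $\sum_{i=1}^n b_i = 0$, one has $\sum_{i,j=1}^n b_i^*\,\alpha_{g_i}\big(\psi(g_i^{-1}g_j)\big)\,b_j \leq 0$ in $A$. It is normalized if $\psi(e)=0$. An $\alpha$-equivariant action $u$ of $G$ on a Hilbert $A$-module $X$ is a homomorphism $g\mapsto u_g$ from $G$ into the group of bijective $\mathbb{C}$-linear isometries from $X$ onto itself such that $\alpha_g(\langle x,y\rangle) = \langle u_g x, u_g y\rangle$ and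 $u_g(x\cdot a) = (u_g x)\cdot \alpha_g(a)$ for all $g\in G$, $x,y\in X$, $a\in A$. A one-cocycle (w.r.t. $u$) is a map $c: G\to X$ with $c(gh) = c(g)+u_g(c(h))$ for all $g,h\in G$. It is symmetric if $\langle c(g),c(h)\rangle \in A_{\mathrm{sa}}$ for all $g,h\in G$, and central if $\langle c(g),c(h)\rangle\in Z(A)$ for all $g,h\in G$. *)

theory Defs
  imports "HOL-Analysis.Analysis" "HOL-Algebra.Ring"
begin

text \<open>
  The real normed algebra structure and the completeness come from the library classes; the complex
  scalar multiplication extends the real one. Class \<^class>\<open>monoid_mult\<close> is used for the unit
  instead of \<^class>\<open>real_normed_algebra_1\<close>, because the latter excludes the zero algebra.
\<close>

class unital_cstar_algebra = real_normed_algebra + banach + monoid_mult +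
  fixes scaleC :: "complex \<Rightarrow> 'a \<Rightarrow> 'a" (infixr \<open>*\<^sub>C\<close> 75)
    and star :: "'a \<Rightarrow> 'a"
  assumes scaleC_add_right: "z *\<^sub>C (x + y) = z *\<^sub>C x + z *\<^sub>C y"
    and scaleC_add_left: "(z + w) *\<^sub>C x = z *\<^sub>C x + w *\<^sub>C x"
    and scaleC_scaleC: "z *\<^sub>C (w *\<^sub>C x) = (z * w) *\<^sub>C x"
    and scaleC_of_real: "complex_of_real r *\<^sub>C x = r *\<^sub>R x"
    and mult_scaleC_left: "(z *\<^sub>C x) * y = z *\<^sub>C (x * y)"
    and mult_scaleC_right: "x * (z *\<^sub>C y) = z *\<^sub>C (x * y)"
    and norm_scaleC: "norm (z *\<^sub>C x) = cmod z * norm x"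
    and star_add: "star (x + y) = star x + star y"
    and star_scaleC: "star (z *\<^sub>C x) = cnj z *\<^sub>C star x"
    and star_mult: "star (x * y) = star y * star x"
    and star_star: "star (star x) = x"
    and cstar_identity: "norm (star x * x) = (norm x)\<^sup>2"

definition self_adjoint :: "'a::unital_cstar_algebra set" where
  "self_adjoint = {a. star a = a}"

definition spectrum :: "'a::unital_cstar_algebra \<Rightarrow> complex set" where
  "spectrum a = {z. \<not> (\<exists>b. b * (z *\<^sub>C 1 - a) = 1 \<and> (z *\<^sub>C 1 - a) * b = 1)}"

definition positive_cone :: "'a::unital_cstar_algebra set" where
  "positive_cone = {a \<in> self_adjoint. spectrum a \<subseteq> \<real>\<^sub>\<ge>\<^sub>0}"

definition cstar_le :: "'a::unital_cstar_algebra \<Rightarrow> 'a \<Rightarrow> bool" (infix \<open>\<le>\<^sub>A\<close> 50) where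
  "a \<le>\<^sub>A b \<longleftrightarrow> b - a \<in> positive_cone"

definition algebra_center :: "'a::unital_cstar_algebra set" where
  "algebra_center = {z. \<forall>a. z * a = a * z}"

definition cstar_automorphism :: "('a::unital_cstar_algebra \<Rightarrow> 'a) \<Rightarrow> bool" where
  "cstar_automorphism f \<longleftrightarrow> bij f \<and>
     (\<forall>x y. f (x + y) = f x + f y) \<and> (\<forall>z x. f (z *\<^sub>C x) = z *\<^sub>C f x) \<and>
     (\<forall>x y. f (x * y) = f x * f y) \<and> (\<forall>x. f (star x) = star (f x))"

text \<open>
  The group is an arbitrary, not necessarily commutative, group. The library class
  \<^class>\<open>group_add\<close> writes it additively: the product \<open>gh\<close> is \<open>g + h\<close>, the inverse of \<open>g\<close> is \<open>- g\<close>
  and the identity \<open>e\<close> is \<open>0\<close>.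
\<close>

definition cstar_action :: "('g::group_add \<Rightarrow> 'a::unital_cstar_algebra \<Rightarrow> 'a) \<Rightarrow> bool" where
  "cstar_action \<alpha> \<longleftrightarrow> (\<forall>g. cstar_automorphism (\<alpha> g)) \<and> (\<forall>g h. \<alpha> (g + h) = \<alpha> g \<circ> \<alpha> h)"

definition negative_definite ::
    "('g::group_add \<Rightarrow> 'a::unital_cstar_algebra \<Rightarrow> 'a) \<Rightarrow> ('g \<Rightarrow> 'a) \<Rightarrow> bool" where
  "negative_definite \<alpha> \<psi> \<longleftrightarrow>
     (\<forall>g. \<alpha> g (\<psi> (- g)) = star (\<psi> g)) \<and>
     (\<forall>(n::nat) (g :: nat \<Rightarrow> 'g) (b :: nat \<Rightarrow> 'a). (\<Sum>i<n. b i) = 0 \<longrightarrow>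
        (\<Sum>i<n. \<Sum>j<n. star (b i) * \<alpha> (g i) (\<psi> (- g i + g j)) * b j) \<le>\<^sub>A 0)"

definition normalized :: "('g::group_add \<Rightarrow> 'a::unital_cstar_algebra) \<Rightarrow> bool" where
  "normalized \<psi> \<longleftrightarrow> \<psi> 0 = 0"

text \<open>
  The module lives on an explicit carrier, so that its existence can be asserted. As in the record
  for modules of the algebra library, the record for rings only supplies the carrier and the
  additive structure, and its fields for multiplication and one are ignored.
\<close>

record ('a, 'x) hilbert_module = "'x ring" +
  cscale :: "complex \<Rightarrow> 'x \<Rightarrow> 'x"
  act :: "'x \<Rightarrow> 'a \<Rightarrow> 'x"
  ip :: "'x \<Rightarrow> 'x \<Rightarrow> 'a"

definition mnorm :: "('a::unital_cstar_algebra, 'x, 'm) hilbert_module_scheme \<Rightarrow> 'x \<Rightarrow> real" where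
  "mnorm X x = sqrt (norm (ip X x x))"

locale hilbert_module = abelian_group X
  for X :: "('a::unital_cstar_algebra, 'x, 'm) hilbert_module_scheme" (structure) +
  assumes cscale_closed: "x \<in> carrier X \<Longrightarrow> cscale X z x \<in> carrier X"
    and cscale_add_right: "\<lbrakk>x \<in> carrier X; y \<in> carrier X\<rbrakk> \<Longrightarrow>
      cscale X z (x \<oplus> y) = cscale X z x \<oplus> cscale X z y"
    and cscale_add_left: "x \<in> carrier X \<Longrightarrow> cscale X (z + w) x = cscale X z x \<oplus> cscale X w x"
    and cscale_cscale: "x \<in> carrier X \<Longrightarrow> cscale X z (cscale X w x) = cscale X (z * w) x"
    and cscale_one: "x \<in> carrier X \<Longrightarrow> cscale X 1 x = x"
    and act_closed: "x \<in> carrier X \<Longrightarrow> act X x a \<in> carrier X"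
    and act_add_left: "\<lbrakk>x \<in> carrier X; y \<in> carrier X\<rbrakk> \<Longrightarrow>
      act X (x \<oplus> y) a = act X x a \<oplus> act X y a"
    and act_add_right: "x \<in> carrier X \<Longrightarrow> act X x (a + b) = act X x a \<oplus> act X x b"
    and act_act: "x \<in> carrier X \<Longrightarrow> act X (act X x a) b = act X x (a * b)"
    and act_one: "x \<in> carrier X \<Longrightarrow> act X x 1 = x"
    and act_cscale_left: "x \<in> carrier X \<Longrightarrow> act X (cscale X z x) a = cscale X z (act X x a)"
    and act_scaleC_right: "x \<in> carrier X \<Longrightarrow> act X x (z *\<^sub>C a) = cscale X z (act X x a)"
    and ip_add_right: "\<lbrakk>x \<in> carrier X; y \<in> carrier X; y' \<in> carrier X\<rbrakk> \<Longrightarrow>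
      ip X x (y \<oplus> y') = ip X x y + ip X x y'"
    and ip_cscale_right: "\<lbrakk>x \<in> carrier X; y \<in> carrier X\<rbrakk> \<Longrightarrow>
      ip X x (cscale X z y) = z *\<^sub>C ip X x y"
    and ip_act_right: "\<lbrakk>x \<in> carrier X; y \<in> carrier X\<rbrakk> \<Longrightarrow> ip X x (act X y a) = ip X x y * a"
    and ip_star: "\<lbrakk>x \<in> carrier X; y \<in> carrier X\<rbrakk> \<Longrightarrow> star (ip X x y) = ip X y x"
    and ip_positive: "x \<in> carrier X \<Longrightarrow> ip X x x \<in> positive_cone"
    and ip_definite: "\<lbrakk>x \<in> carrier X; ip X x x = 0\<rbrakk> \<Longrightarrow> x = \<zero>"
    and complete: "\<lbrakk>\<And>n::nat. s n \<in> carrier X;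
        \<And>e. e > 0 \<Longrightarrow> \<exists>N. \<forall>m\<ge>N. \<forall>n\<ge>N. mnorm X (s m \<ominus> s n) < e\<rbrakk> \<Longrightarrow>
      \<exists>x\<in>carrier X. (\<lambda>n. mnorm X (s n \<ominus> x)) \<longlonglongrightarrow> 0"

definition hilbert_submodule ::
    "('a::unital_cstar_algebra, 'x, 'm) hilbert_module_scheme \<Rightarrow> 'x set \<Rightarrow> bool" where
  "hilbert_submodule X S \<longleftrightarrow> S \<subseteq> carrier X \<and> \<zero>\<^bsub>X\<^esub> \<in> S \<and>
     (\<forall>x\<in>S. \<forall>y\<in>S. x \<oplus>\<^bsub>X\<^esub> y \<in> S) \<and> (\<forall>x\<in>S. \<forall>z. cscale X z x \<in> S) \<and>
     (\<forall>x\<in>S. \<forall>a. act X x a \<in> S)"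

definition generated_submodule ::
    "('a::unital_cstar_algebra, 'x, 'm) hilbert_module_scheme \<Rightarrow> 'x set \<Rightarrow> 'x set" where
  "generated_submodule X C = hilbert_submodule X hull C"

definition dense_in_module ::
    "('a::unital_cstar_algebra, 'x, 'm) hilbert_module_scheme \<Rightarrow> 'x set \<Rightarrow> bool" where
  "dense_in_module X S \<longleftrightarrow> (\<forall>x\<in>carrier X. \<forall>e>0. \<exists>y\<in>S. mnorm X (x \<ominus>\<^bsub>X\<^esub> y) < e)"

definition linear_isometric_bijection ::
    "('a::unital_cstar_algebra, 'x, 'm) hilbert_module_scheme \<Rightarrow> ('x \<Rightarrow> 'x) \<Rightarrow> bool" where
  "linear_isometric_bijection X f \<longleftrightarrow> bij_betw f (carrier X) (carrier X) \<and>
     (\<forall>x\<in>carrier X. \<forall>y\<in>carrier X. f (x \<oplus>\<^bsub>X\<^esub> y) = f x \<oplus>\<^bsub>X\<^esub> f y) \<and>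
     (\<forall>x\<in>carrier X. \<forall>z. f (cscale X z x) = cscale X z (f x)) \<and>
     (\<forall>x\<in>carrier X. mnorm X (f x) = mnorm X x)"

definition equivariant_action ::
    "('g::group_add \<Rightarrow> 'a::unital_cstar_algebra \<Rightarrow> 'a) \<Rightarrow>
     ('a, 'x, 'm) hilbert_module_scheme \<Rightarrow> ('g \<Rightarrow> 'x \<Rightarrow> 'x) \<Rightarrow> bool" where
  "equivariant_action \<alpha> X u \<longleftrightarrow>
     (\<forall>g. linear_isometric_bijection X (u g)) \<and>
     (\<forall>g h. \<forall>x\<in>carrier X. u (g + h) x = u g (u h x)) \<and>
     (\<forall>g. \<forall>x\<in>carrier X. \<forall>y\<in>carrier X. \<alpha> g (ip X x y) = ip X (u g x) (u g y)) \<and>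
     (\<forall>g. \<forall>x\<in>carrier X. \<forall>a. u g (act X x a) = act X (u g x) (\<alpha> g a))"

definition one_cocycle ::
    "('a::unital_cstar_algebra, 'x, 'm) hilbert_module_scheme \<Rightarrow>
     ('g::group_add \<Rightarrow> 'x \<Rightarrow> 'x) \<Rightarrow> ('g \<Rightarrow> 'x) \<Rightarrow> bool" where
  "one_cocycle X u c \<longleftrightarrow> (\<forall>g. c g \<in> carrier X) \<and> (\<forall>g h. c (g + h) = c g \<oplus>\<^bsub>X\<^esub> u g (c h))"

definition symmetric_cocycle ::
    "('a::unital_cstar_algebra, 'x, 'm) hilbert_module_scheme \<Rightarrow> ('g \<Rightarrow> 'x) \<Rightarrow> bool" where
  "symmetric_cocycle X c \<longleftrightarrow> (\<forall>g h. ip X (c g) (c h) \<in> self_adjoint)"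

definition central_cocycle ::
    "('a::unital_cstar_algebra, 'x, 'm) hilbert_module_scheme \<Rightarrow> ('g \<Rightarrow> 'x) \<Rightarrow> bool" where
  "central_cocycle X c \<longleftrightarrow> (\<forall>g h. ip X (c g) (c h) \<in> algebra_center)"

text \<open>
  An existence claim in HOL has to name the type on which the carrier of the module lives. For a
  cocycle \<open>c\<close> whose values generate a dense submodule, the map sending \<open>x\<close> to the function
  \<open>g \<mapsto> ip X (c g) x\<close> is injective on the carrier. Hence functions from the group to the algebra
  are a sufficiently large type for the elements of such a module.
\<close>

end

theory Submission
  imports Defs
begin

text \<open>
  If the cocycle \<open>c\<close> exists, then \<open>\<alpha>\<^sub>g(\<psi>(g\<^sup>-\<^sup>1 h)) = \<langle>c(g) - c(h), c(g) - c(h)\<rangle>\<close>, so for a symmetric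
  \<open>c\<close> the inner products are forced to be
  \<open>K(g, h) = \<langle>c(g), c(h)\<rangle> = \<onehalf>(\<psi>(g) + \<psi>(h) - \<alpha>\<^sub>g(\<psi>(g\<^sup>-\<^sup>1 h)))\<close>.  Conversely, negative definiteness of
  \<open>\<psi>\<close> makes \<open>K\<close> a positive definite kernel (\<open>K_positive\<close>), and \<open>c\<close> can be taken to be the
  family of kernel functions \<open>k\<^sub>h = K(\<cdot>, h)\<close> in the Hilbert module with reproducing kernel \<open>K\<close>.  The
  action is determined by \<open>u\<^sub>g k\<^sub>h = k\<^sub>g\<^sub>h - k\<^sub>g\<close>, which is exactly the cocycle identity, and the twisted
  invariance of \<open>K\<close> (\<open>K_translate\<close>) makes it \<open>\<alpha>\<close>-equivariant.  Symmetry and centrality of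
  \<open>c\<close> are visible in the formula for \<open>K\<close>.

  The module is realized by functions on the group.  Finite combinations \<open>\<Sum> k\<^sub>t b\<^sub>t\<close> carry the
  inner product dictated by \<open>\<langle>k\<^sub>s, k\<^sub>t\<rangle> = K(s, t)\<close>; the completion consists of the pointwise limits of
  Cauchy sequences of such combinations.  It is a space of functions because a Cauchy sequence which
  tends to \<open>0\<close> pointwise tends to \<open>0\<close> in norm
  (\<open>seminorm_tendsto_zero_if_pointwise\<close>).

  The analytic input is the Cauchy--Schwarz inequality for inner products with values in a
  \<open>C\<^sup>*\<close>-algebra, together with the facts that the positive cone is closed and that automorphisms are
  contractive.  All of these rest on one theorem on spectra: a self-adjoint \<open>a \<noteq> 0\<close> has a spectral
  value of modulus \<open>\<parallel>a\<parallel>\<close> (\<open>norm_in_spectrum_self_adjoint\<close>).  The proof compares the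
  resolvent on the unit circle with the resolvent on a slightly smaller circle, and passes to powers
  of the element by averaging over roots of unity.  The Cauchy--Schwarz inequality follows from
  \<open>\<parallel>b\<parallel>\<^sup>2 \<le> \<parallel>p\<parallel>\<close> whenever \<open>b\<^sup>* b \<le> p\<close> (\<open>norm_square_le_if_dominated\<close>).
\<close>

section \<open>Complex scalars and the involution\<close>

lemma scaleC_one [simp]: "1 *\<^sub>C (x :: 'a::unital_cstar_algebra) = x"
  using scaleC_of_real[of 1 x] by simp

lemma scaleC_zero_left [simp]: "0 *\<^sub>C (x :: 'a::unital_cstar_algebra) = 0"
  using scaleC_of_real[of 0 x] by simp

lemma scaleC_zero_right [simp]: "z *\<^sub>C (0 :: 'a::unital_cstar_algebra) = 0"
  using scaleC_add_right[of z 0 "0::'a"] by simp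

lemma scaleC_minus_left: "(- z) *\<^sub>C (x :: 'a::unital_cstar_algebra) = - (z *\<^sub>C x)"
  using scaleC_add_left[of z "- z" x] by (simp add: eq_neg_iff_add_eq_0 add.commute)

lemma scaleC_minus_right: "z *\<^sub>C (- (x :: 'a::unital_cstar_algebra)) = - (z *\<^sub>C x)"
  using scaleC_add_right[of z x "- x"] by (simp add: eq_neg_iff_add_eq_0 add.commute)

lemma scaleC_diff_left: "(z - w) *\<^sub>C (x :: 'a::unital_cstar_algebra) = z *\<^sub>C x - w *\<^sub>C x"
  using scaleC_add_left[of z "- w" x] by (simp add: scaleC_minus_left)

lemma scaleC_diff_right: "z *\<^sub>C ((x :: 'a::unital_cstar_algebra) - y) = z *\<^sub>C x - z *\<^sub>C y"
  using scaleC_add_right[of z x "- y"] by (simp add: scaleC_minus_right)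

lemma star_zero [simp]: "star (0 :: 'a::unital_cstar_algebra) = 0"
  using star_add[of 0 "0::'a"] by simp

lemma star_minus: "star (- (x :: 'a::unital_cstar_algebra)) = - star x"
  using star_add[of x "- x"] by (simp add: eq_neg_iff_add_eq_0 add.commute)

lemma star_diff: "star ((x :: 'a::unital_cstar_algebra) - y) = star x - star y"
  using star_add[of x "- y"] by (simp add: star_minus)

lemma star_one [simp]: "star (1 :: 'a::unital_cstar_algebra) = 1"
  by (metis mult.right_neutral mult.left_neutral star_mult star_star)

lemma star_scaleR: "star (r *\<^sub>R (x :: 'a::unital_cstar_algebra)) = r *\<^sub>R star x"
  using star_scaleC[of "complex_of_real r" x] by (simp add: scaleC_of_real)

lemma norm_star [simp]: "norm (star (x :: 'a::unital_cstar_algebra)) = norm x"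
proof -
  have le: "norm y \<le> norm (star y)" for y :: 'a
  proof (cases "y = 0")
    case False
    have "(norm y)\<^sup>2 \<le> norm (star y) * norm y"
      using norm_mult_ineq[of "star y" y] by (simp add: cstar_identity)
    then show ?thesis using False by (simp add: power2_eq_square)
  qed simp
  show ?thesis using le[of x] le[of "star x"] by (simp add: star_star)
qed

lemma tendsto_star:
  fixes f :: "'b \<Rightarrow> 'a::unital_cstar_algebra"
  assumes "(f \<longlongrightarrow> l) F"
  shows "((\<lambda>x. star (f x)) \<longlongrightarrow> star l) F"
proof -
  have "((\<lambda>x. norm (star (f x) - star l)) \<longlongrightarrow> 0) F"
    using assms by (simp add: tendsto_norm_zero LIM_zero flip: star_diff)
  then show ?thesis by (simp add: LIM_zero_cancel tendsto_norm_zero_iff)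
qed

lemma norm_one_le: "norm (1 :: 'a::unital_cstar_algebra) \<le> 1"
proof -
  have "norm (1::'a) = (norm (1::'a))\<^sup>2" using cstar_identity[of "1::'a"] by simp
  then show ?thesis by (metis order_refl power2_eq_square mult_cancel_right1 zero_le_one)
qed

section \<open>Inverses and spectra\<close>

definition has_inverse :: "'a::monoid_mult \<Rightarrow> bool" where
  "has_inverse a \<longleftrightarrow> (\<exists>b. b * a = 1 \<and> a * b = 1)"

lemma in_spectrum_iff: "z \<in> spectrum a \<longleftrightarrow> \<not> has_inverse (z *\<^sub>C 1 - a)"
  by (simp add: spectrum_def has_inverse_def)

lemma has_inverse_mult: "has_inverse a \<Longrightarrow> has_inverse b \<Longrightarrow> has_inverse (a * b)"
proof -
  assume "has_inverse a" "has_inverse b"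
  then obtain c d where "c * a = 1" "a * c = 1" "d * b = 1" "b * d = 1"
    by (auto simp: has_inverse_def)
  moreover have "(d * c) * (a * b) = d * (c * a) * b" "(a * b) * (d * c) = a * (b * d) * c"
    by (simp_all only: mult.assoc)
  ultimately have "(d * c) * (a * b) = 1 \<and> (a * b) * (d * c) = 1" by simp
  then show ?thesis unfolding has_inverse_def by blast
qed

lemma has_inverse_scaleC:
  fixes a :: "'a::unital_cstar_algebra"
  assumes "z \<noteq> 0"
  shows "has_inverse (z *\<^sub>C a) \<longleftrightarrow> has_inverse a"
proof -
  have imp: "has_inverse (w *\<^sub>C x)" if x: "has_inverse x" and w: "w \<noteq> 0" for w and x :: 'a
  proof -
    obtain y where "y * x = 1" "x * y = 1" using x by (auto simp: has_inverse_def)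
    then have "(inverse w *\<^sub>C y) * (w *\<^sub>C x) = 1 \<and> (w *\<^sub>C x) * (inverse w *\<^sub>C y) = 1"
      using w by (simp add: mult_scaleC_left mult_scaleC_right scaleC_scaleC)
    then show ?thesis unfolding has_inverse_def by blast
  qed
  show ?thesis
    using imp[of a z] imp[of "z *\<^sub>C a" "inverse z"] assms by (auto simp: scaleC_scaleC)
qed

lemma has_inverse_minus: "has_inverse (- (a :: 'a::unital_cstar_algebra)) \<longleftrightarrow> has_inverse a"
  using has_inverse_scaleC[of "-1" a] by (simp add: scaleC_minus_left)

lemma spectrum_shift: "w \<in> spectrum (z *\<^sub>C 1 - a) \<longleftrightarrow> z - w \<in> spectrum a"
  using has_inverse_minus[of "w *\<^sub>C 1 - (z *\<^sub>C 1 - a)"]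
  by (simp add: in_spectrum_iff scaleC_diff_left algebra_simps)

lemma spectrum_shift_real:
  "w \<in> spectrum (t *\<^sub>R 1 - a) \<longleftrightarrow> complex_of_real t - w \<in> spectrum a"
  using spectrum_shift[of w "complex_of_real t" a] by (simp add: scaleC_of_real)

text \<open>
  If \<open>c\<close> inverts \<open>z - b a\<close>, then \<open>z\<^sup>-\<^sup>1 (1 + a c b)\<close> inverts \<open>z - a b\<close>; expanding both as
  geometric series suggests the formula.
\<close>

lemma spectrum_mult_commute:
  fixes a b :: "'a::unital_cstar_algebra"
  assumes "z \<in> spectrum (a * b)" and z: "z \<noteq> 0"
  shows "z \<in> spectrum (b * a)"
proof (rule ccontr)
  assume "z \<notin> spectrum (b * a)"
  then obtain c where c: "c * (z *\<^sub>C 1 - b * a) = 1" "(z *\<^sub>C 1 - b * a) * c = 1"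
    by (auto simp: in_spectrum_iff has_inverse_def)
  have c1: "z *\<^sub>C c - c * (b * a) = 1" "z *\<^sub>C c - b * (a * c) = 1"
    using c by (simp_all add: algebra_simps mult_scaleC_left mult_scaleC_right)
  define d where "d = 1 + a * c * b"
  have l: "a * (c * (b * (a * b))) = z *\<^sub>C (a * (c * b)) - a * b"
    using arg_cong[OF c1(1), of "\<lambda>x. a * x * b"]
    by (simp add: algebra_simps mult_scaleC_left mult_scaleC_right)
  have r: "a * (b * (a * (c * b))) = z *\<^sub>C (a * (c * b)) - a * b"
    using arg_cong[OF c1(2), of "\<lambda>x. a * x * b"]
    by (simp add: algebra_simps mult_scaleC_left mult_scaleC_right)
  have "d * (z *\<^sub>C 1 - a * b) = z *\<^sub>C 1" "(z *\<^sub>C 1 - a * b) * d = z *\<^sub>C 1"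
    unfolding d_def
    using l r by (simp_all add: algebra_simps mult_scaleC_left mult_scaleC_right scaleC_add_right)
  then have "(inverse z *\<^sub>C d) * (z *\<^sub>C 1 - a * b) = 1 \<and> (z *\<^sub>C 1 - a * b) * (inverse z *\<^sub>C d) = 1"
    using z by (simp add: mult_scaleC_left mult_scaleC_right scaleC_scaleC)
  with assms(1) show False by (auto simp: in_spectrum_iff has_inverse_def)
qed

lemma norm_power_Suc_le: "norm ((a :: 'a::unital_cstar_algebra) ^ Suc n) \<le> norm a ^ Suc n"
proof (induction n)
  case (Suc n)
  have "norm (a ^ Suc (Suc n)) \<le> norm a * norm (a ^ Suc n)"
    using norm_mult_ineq[of a "a ^ Suc n"] by simp
  also have "\<dots> \<le> norm a * norm a ^ Suc n"
    using Suc by (intro mult_left_mono) auto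
  finally show ?case by simp
qed simp

lemma has_inverse_one_minus:
  fixes a :: "'a::unital_cstar_algebra"
  assumes "norm a < 1"
  shows "has_inverse (1 - a)"
proof -
  have sm: "summable (\<lambda>n. a ^ n)"
  proof (rule summable_comparison_test')
    show "summable (\<lambda>n. norm a ^ n)" using assms by (simp add: summable_geometric)
    show "norm (a ^ n) \<le> norm a ^ n" for n
      using norm_power_Suc_le[of a] norm_one_le by (cases n) auto
  qed
  have "(\<lambda>n. a ^ n - a ^ Suc n) sums (a ^ 0 - 0)"
    by (rule telescope_sums'[OF summable_LIMSEQ_zero[OF sm]])
  then have tel: "(\<Sum>n. a ^ n - a ^ Suc n) = 1"
    by (simp add: sums_iff)
  have "suminf (\<lambda>n. a ^ n) * (1 - a) = 1"
    using suminf_mult2[OF sm, of "1 - a"] tel by (simp add: algebra_simps power_commutes)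
  moreover have "(1 - a) * suminf (\<lambda>n. a ^ n) = 1"
    using suminf_mult[OF sm, of "1 - a"] tel by (simp add: algebra_simps)
  ultimately show ?thesis unfolding has_inverse_def by blast
qed

lemma spectrum_norm_bound:
  assumes "z \<in> spectrum a"
  shows "cmod z \<le> norm a"
proof (rule ccontr)
  assume less: "\<not> cmod z \<le> norm a"
  then have z: "z \<noteq> 0" using norm_ge_zero[of a] by force
  have "norm (inverse z *\<^sub>C a) < 1"
    using less z by (simp add: norm_scaleC norm_inverse inverse_eq_divide norm_divide divide_less_eq)
  then have "has_inverse (z *\<^sub>C (1 - inverse z *\<^sub>C a))"
    using z by (simp add: has_inverse_one_minus has_inverse_scaleC)
  moreover have "z *\<^sub>C (1 - inverse z *\<^sub>C a) = z *\<^sub>C 1 - a"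
    using z by (simp add: scaleC_diff_right scaleC_scaleC)
  ultimately show False using assms by (simp add: in_spectrum_iff)
qed

text \<open>
  Shift \<open>a\<close> by \<open>\<i>s\<close>: the \<open>C\<^sup>*\<close>-identity bounds \<open>\<bar>z + \<i>s\<bar>\<^sup>2\<close> by \<open>\<parallel>a\<parallel>\<^sup>2 + s\<^sup>2\<close> for every real \<open>s\<close>,
  which leaves no room for a term linear in \<open>s\<close>.
\<close>

lemma spectrum_self_adjoint_real:
  fixes a :: "'a::unital_cstar_algebra"
  assumes sa: "a \<in> self_adjoint" and z: "z \<in> spectrum a"
  shows "Im z = 0"
proof (rule ccontr)
  assume nz: "Im z \<noteq> 0"
  have bound: "(Re z)\<^sup>2 + (Im z + s)\<^sup>2 \<le> (norm a)\<^sup>2 + s\<^sup>2" for s :: real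
  proof -
    define w where "w = \<i> * complex_of_real s"
    have "- w - z \<in> spectrum ((- w) *\<^sub>C 1 - a)"
      using z by (simp add: spectrum_shift)
    then have "(cmod (- w - z))\<^sup>2 \<le> (norm ((- w) *\<^sub>C 1 - a))\<^sup>2"
      by (simp add: spectrum_norm_bound power_mono)
    also have "\<dots> = norm (star ((- w) *\<^sub>C 1 - a) * ((- w) *\<^sub>C 1 - a))"
      by (simp add: cstar_identity)
    also have "star ((- w) *\<^sub>C 1 - a) * ((- w) *\<^sub>C 1 - a) = star a * a + (s * s) *\<^sub>R 1"
    proof -
      have "complex_of_real s * complex_of_real s = complex_of_real (s * s)" by simp
      then have "(- (w * w)) *\<^sub>C (1::'a) = (s * s) *\<^sub>R 1"
        unfolding w_def by (metis (no_types, opaque_lifting) i_squared mult.assoc mult.left_commute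
            mult_minus1 minus_minus scaleC_of_real)
      then have "(w * w) *\<^sub>C (1::'a) + (s * s) *\<^sub>R 1 = 0"
        by (simp add: scaleC_minus_left eq_neg_iff_add_eq_0 flip: neg_eq_iff_add_eq_0)
      moreover have "star a = a" using sa by (simp add: self_adjoint_def)
      moreover have "cnj w = - w" by (simp add: w_def)
      ultimately show ?thesis
        by (simp add: star_diff star_scaleC algebra_simps mult_scaleC_left mult_scaleC_right
            scaleC_scaleC scaleC_minus_left scaleC_diff_right scaleC_add_right star_minus)
    qed
    also have "norm \<dots> \<le> (norm a)\<^sup>2 + s\<^sup>2"
    proof -
      have "norm ((s * s) *\<^sub>R (1::'a)) \<le> s\<^sup>2"
        using norm_one_le[where 'a='a] by (simp add: power2_eq_square mult_left_le)
      then show ?thesis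
        using norm_triangle_ineq[of "star a * a" "(s * s) *\<^sub>R 1"] by (simp add: cstar_identity)
    qed
    finally have "(cmod (- w - z))\<^sup>2 \<le> (norm a)\<^sup>2 + s\<^sup>2" .
    moreover have "(cmod (- w - z))\<^sup>2 = (Re z)\<^sup>2 + (Im z + s)\<^sup>2"
      unfolding cmod_power2 by (simp add: w_def power2_eq_square algebra_simps)
    ultimately show ?thesis by simp
  qed
  have "2 * Im z * (((norm a)\<^sup>2 + 1) / (2 * Im z)) = (norm a)\<^sup>2 + 1"
    using nz by simp
  then show False
    using bound[of "((norm a)\<^sup>2 + 1) / (2 * Im z)"] zero_le_power2[of "Re z"] zero_le_power2[of "Im z"]
    unfolding power2_sum by linarith
qed

section \<open>The spectral radius of a self-adjoint element\<close>

text \<open>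
  The resolvent identity \<open>R z - R w = (z - w) R z b R w\<close> bounds \<open>R z\<close> by \<open>2 \<parallel>R w\<parallel>\<close> once
  \<open>\<bar>z - w\<bar> \<parallel>b\<parallel> \<parallel>R w\<parallel> < \<onehalf>\<close>, and then gives continuity at \<open>w\<close>.
\<close>

lemma resolvent_continuous:
  fixes b :: "'a::unital_cstar_algebra"
  assumes R: "\<And>z. z \<in> S \<Longrightarrow> R z * (1 - z *\<^sub>C b) = 1 \<and> (1 - z *\<^sub>C b) * R z = 1"
  shows "continuous_on S R"
  unfolding continuous_on_def
proof
  fix w assume w: "w \<in> S"
  let ?c = "norm b * norm (R w)"
  have id: "R z - R w = (z - w) *\<^sub>C (R z * b * R w)" if "z \<in> S" for z
  proof -
    have "R z - R w = R z * ((1 - w *\<^sub>C b) * R w) - (R z * (1 - z *\<^sub>C b)) * R w"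
      using R[OF w] R[OF that] by simp
    also have "\<dots> = R z * ((1 - w *\<^sub>C b) - (1 - z *\<^sub>C b)) * R w"
      by (simp add: algebra_simps)
    finally show ?thesis
      by (simp add: mult_scaleC_left mult_scaleC_right algebra_simps scaleC_diff_left)
  qed
  have nid: "norm (R z - R w) \<le> cmod (z - w) * ?c * norm (R z)" if "z \<in> S" for z
  proof -
    have "norm (R z * b * R w) \<le> norm (R z) * norm b * norm (R w)"
      by (meson mult_right_mono norm_ge_zero norm_mult_ineq order_trans)
    then show ?thesis
      using mult_left_mono[of "norm (R z * b * R w)" "norm (R z) * norm b * norm (R w)" "cmod (z - w)"]
      by (simp add: id[OF that] norm_scaleC mult.commute mult.left_commute mult.assoc)
  qed
  have lim: "((\<lambda>z. cmod (z - w) * ?c) \<longlongrightarrow> 0) (at w within S)"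
    by (auto intro!: tendsto_eq_intros)
  then have ev: "\<forall>\<^sub>F z in at w within S. cmod (z - w) * ?c < 1/2"
    by (rule order_tendstoD) simp
  have "\<forall>\<^sub>F z in at w within S. norm (R z - R w) \<le> cmod (z - w) * ?c * (2 * norm (R w))"
  proof -
    have "\<forall>\<^sub>F z in at w within S. z \<in> S" by (simp add: eventually_at_filter)
    with ev show ?thesis
    proof eventually_elim
      case (elim z)
      have "norm (R z - R w) \<le> 1/2 * norm (R z)"
        using nid[OF elim(2)] elim(1) mult_right_mono[of "cmod (z - w) * ?c" "1/2" "norm (R z)"] by simp
      moreover have "norm (R z) \<le> norm (R w) + norm (R z - R w)"
        using norm_triangle_sub by blast
      ultimately have "norm (R z) \<le> 2 * norm (R w)" by simp
      then have "cmod (z - w) * ?c * norm (R z) \<le> cmod (z - w) * ?c * (2 * norm (R w))"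
        by (intro mult_left_mono) auto
      with nid[OF elim(2)] show ?case by simp
    qed
  qed
  moreover have "((\<lambda>z. cmod (z - w) * ?c * (2 * norm (R w))) \<longlongrightarrow> 0) (at w within S)"
    using tendsto_mult_left_zero[OF lim] by simp
  ultimately have "((\<lambda>z. R z - R w) \<longlongrightarrow> 0) (at w within S)"
    by (rule Lim_null_comparison)
  then show "(R \<longlongrightarrow> R w) (at w within S)" by (rule LIM_zero_cancel)
qed

lemma inverse_one_minus_square:
  fixes w :: "'a::unital_cstar_algebra"
  assumes "p * (1 - w) = 1" "(1 - w) * p = 1" "q * (1 + w) = 1" "(1 + w) * q = 1"
  shows "((1/2) *\<^sub>R (p + q)) * (1 - w * w) = 1" "(1 - w * w) * ((1/2) *\<^sub>R (p + q)) = 1"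
proof -
  have two: "(1/2) *\<^sub>R (x + x) = x" for x :: 'a
    by (simp add: scaleR_2[symmetric])
  have "p * (1 - w * w) = p * (1 - w) * (1 + w)" "q * (1 - w * w) = q * (1 + w) * (1 - w)"
    by (simp_all add: algebra_simps)
  then have "(p + q) * (1 - w * w) = 1 + 1"
    using assms by (simp add: distrib_right)
  then show "((1/2) *\<^sub>R (p + q)) * (1 - w * w) = 1" by (simp add: two)
  have "(1 - w * w) * p = (1 + w) * ((1 - w) * p)" "(1 - w * w) * q = (1 - w) * ((1 + w) * q)"
    by (simp_all add: algebra_simps)
  then have "(1 - w * w) * (p + q) = 1 + 1"
    using assms by (simp add: distrib_left)
  then show "(1 - w * w) * ((1/2) *\<^sub>R (p + q)) = 1" by (simp add: two)
qed

text \<open>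
  The identity \<open>(1 - w\<^sup>2)\<^sup>-\<^sup>1 = \<onehalf>((1 - w)\<^sup>-\<^sup>1 + (1 + w)\<^sup>-\<^sup>1)\<close> turns a bound between resolvents at
  radius \<open>s\<close> and at radius \<open>1\<close> into the same bound for the powers with exponent \<open>2 ^ m\<close>.  The term
  \<open>1 + w\<close> is again of the form under consideration, because \<open>- 1\<close> has a
  \<open>2 ^ m\<close>-th root on the unit circle.
\<close>

lemma resolvent_power_close:
  fixes b :: "'a::unital_cstar_algebra" and s :: real and z :: complex
  assumes base: "\<And>z::complex. cmod z = 1 \<Longrightarrow> \<exists>u v.
      u * (1 - (s * z) *\<^sub>C b) = 1 \<and> (1 - (s * z) *\<^sub>C b) * u = 1 \<and>
      v * (1 - z *\<^sub>C b) = 1 \<and> (1 - z *\<^sub>C b) * v = 1 \<and> norm (u - v) \<le> e"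
    and z: "cmod z = 1"
  shows "\<exists>u v.
      u * (1 - ((s * z) ^ (2 ^ m)) *\<^sub>C b ^ (2 ^ m)) = 1 \<and>
      (1 - ((s * z) ^ (2 ^ m)) *\<^sub>C b ^ (2 ^ m)) * u = 1 \<and>
      v * (1 - (z ^ (2 ^ m)) *\<^sub>C b ^ (2 ^ m)) = 1 \<and>
      (1 - (z ^ (2 ^ m)) *\<^sub>C b ^ (2 ^ m)) * v = 1 \<and> norm (u - v) \<le> e"
  using z
proof (induction m arbitrary: z)
  case 0
  then show ?case using base[of z] by simp
next
  case (Suc m)
  define x where "x = cis (pi / 2 ^ m)"
  have "x ^ (2 ^ m) = cis (real (2 ^ m) * (pi / 2 ^ m))"
    unfolding x_def by (simp only: Complex.DeMoivre)
  then have x: "x ^ (2 ^ m) = -1" "cmod x = 1" by (simp_all add: x_def)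
  define d where "d = b ^ (2 ^ m)"
  define w where "w = ((s * z) ^ (2 ^ m)) *\<^sub>C d"
  define w' where "w' = (z ^ (2 ^ m)) *\<^sub>C d"
  from Suc.IH[OF Suc.prems] obtain p p' where p:
    "p * (1 - w) = 1" "(1 - w) * p = 1" "p' * (1 - w') = 1" "(1 - w') * p' = 1" "norm (p - p') \<le> e"
    by (auto simp: w_def w'_def d_def)
  have "cmod (x * z) = 1" using Suc.prems x by (simp add: norm_mult)
  from Suc.IH[OF this] obtain q q' where q:
    "q * (1 + w) = 1" "(1 + w) * q = 1" "q' * (1 + w') = 1" "(1 + w') * q' = 1" "norm (q - q') \<le> e"
    using x(1) by (auto simp: w_def w'_def d_def power_mult_distrib scaleC_minus_left)
  have sq: "w * w = ((s * z) ^ (2 ^ Suc m)) *\<^sub>C b ^ (2 ^ Suc m)"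
    "w' * w' = (z ^ (2 ^ Suc m)) *\<^sub>C b ^ (2 ^ Suc m)"
    by (simp_all add: w_def w'_def d_def mult_scaleC_left mult_scaleC_right scaleC_scaleC mult_2
        power_add)
  have "norm ((1/2) *\<^sub>R (p + q) - (1/2) *\<^sub>R (p' + q')) \<le> e"
  proof -
    have "(1/2) *\<^sub>R (p + q) - (1/2) *\<^sub>R (p' + q') = (1/2) *\<^sub>R ((p - p') + (q - q'))"
      by (simp add: algebra_simps)
    then show ?thesis using norm_triangle_ineq[of "p - p'" "q - q'"] p(5) q(5) by simp
  qed
  then show ?case
    unfolding sq[symmetric]
    using inverse_one_minus_square[OF p(1,2) q(1,2)] inverse_one_minus_square[OF p(3,4) q(3,4)]
    by blast
qed

text \<open>
  The resolvent is uniformly continuous on the closed unit disc if it is defined there.  Hence the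
  inverses of \<open>1 - (s b) ^ n\<close> and of \<open>1 - b ^ n\<close>, for \<open>n = 2 ^ m\<close>, are close uniformly in \<open>m\<close>
  when \<open>s < 1\<close> is close to \<open>1\<close>.  The former tends to \<open>1\<close> as \<open>m\<close> grows, so \<open>b ^ n\<close> becomes small.
\<close>

lemma not_has_inverse_on_circle:
  fixes b :: "'a::unital_cstar_algebra"
  assumes n1: "norm b = 1" and pow: "\<And>m. norm (b ^ (2 ^ m)) = 1"
  shows "\<exists>z. cmod z = 1 \<and> \<not> has_inverse (1 - z *\<^sub>C b)"
proof (rule ccontr)
  assume contr: "\<not> ?thesis"
  have inv: "has_inverse (1 - z *\<^sub>C b)" if "cmod z \<le> 1" for z
  proof (cases "cmod z = 1")
    case False
    then show ?thesis using that n1 by (intro has_inverse_one_minus) (simp add: norm_scaleC)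
  qed (use contr in auto)
  define R where "R z = (SOME r. r * (1 - z *\<^sub>C b) = 1 \<and> (1 - z *\<^sub>C b) * r = 1)" for z
  have R: "R z * (1 - z *\<^sub>C b) = 1 \<and> (1 - z *\<^sub>C b) * R z = 1" if "z \<in> cball 0 1" for z
  proof -
    have "\<exists>r. r * (1 - z *\<^sub>C b) = 1 \<and> (1 - z *\<^sub>C b) * r = 1"
      using inv[of z] that by (simp add: has_inverse_def)
    from someI_ex[OF this] show ?thesis unfolding R_def .
  qed
  have "uniformly_continuous_on (cball 0 1) R"
    using resolvent_continuous[of "cball 0 1" R b] R by (intro compact_uniformly_continuous) auto
  then have "\<exists>\<delta>>0. \<forall>z\<in>cball 0 1. \<forall>w\<in>cball 0 1. dist w z < \<delta> \<longrightarrow> dist (R w) (R z) < 1/8"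
    unfolding uniformly_continuous_on_def by (elim allE[of _ "1/8"]) simp
  then obtain \<delta> where \<delta>: "\<delta> > 0"
    "\<And>z w. z \<in> cball 0 1 \<Longrightarrow> w \<in> cball 0 1 \<Longrightarrow> dist w z < \<delta> \<Longrightarrow> dist (R w) (R z) < 1/8"
    by blast
  define s where "s = max 0 (1 - \<delta> / 2)"
  have s: "0 \<le> s" "s < 1" "1 - s < \<delta>" using \<delta>(1) by (auto simp: s_def)
  have base: "\<exists>u v. u * (1 - (s * z) *\<^sub>C b) = 1 \<and> (1 - (s * z) *\<^sub>C b) * u = 1 \<and>
      v * (1 - z *\<^sub>C b) = 1 \<and> (1 - z *\<^sub>C b) * v = 1 \<and> norm (u - v) \<le> 1/8"
    if z: "cmod z = 1" for z :: complex
  proof -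
    have "dist (s * z) z = cmod (complex_of_real (s - 1) * z)"
      by (simp add: dist_norm algebra_simps)
    also have "\<dots> = 1 - s"
      unfolding norm_mult norm_of_real using z s by simp
    finally have "dist (R (s * z)) (R z) < 1/8"
      using s z by (intro \<delta>) (auto simp: norm_mult)
    moreover have "s * z \<in> cball 0 1" "z \<in> cball 0 1" using s z by (auto simp: norm_mult)
    ultimately show ?thesis
      using R[of "s * z"] R[of z]
      by (intro exI[of _ "R (s * z)"] exI[of _ "R z"]) (simp add: dist_norm)
  qed
  \<comment> \<open>Any error below \<open>1/2\<close> in \<open>v \<approx> 1\<close> contradicts \<open>\<parallel>b ^ n\<parallel> = 1\<close>; the bounds \<open>1/8\<close> and \<open>1/10\<close> give \<open>1/4\<close>.\<close>
  obtain k where k: "s ^ k < 1/10" using real_arch_pow_inv[of "1/10" s] s by auto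
  have "s ^ (2 ^ k) \<le> s ^ k" using s by (intro power_decreasing) auto
  then have small: "s ^ (2 ^ k) < 1/10" using k by linarith
  obtain u v where uv: "u * (1 - (complex_of_real s ^ (2 ^ k)) *\<^sub>C b ^ (2 ^ k)) = 1"
    "v * (1 - b ^ (2 ^ k)) = 1" "norm (u - v) \<le> 1/8"
    using resolvent_power_close[of s b "1/8" 1 k, OF base] by auto
  define d where "d = b ^ (2 ^ k)"
  define w where "w = (complex_of_real s ^ (2 ^ k)) *\<^sub>C d"
  have nw: "norm w < 1/10" and nd: "norm d = 1"
    using small pow[of k] s by (simp_all add: w_def d_def norm_scaleC norm_power)
  have "u - 1 = u * w"
    using uv(1) by (simp add: w_def d_def algebra_simps)
  then have "norm (u - 1) \<le> norm u * norm w" by (simp add: norm_mult_ineq)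
  also have "\<dots> \<le> norm u * (1/10)" using nw by (intro mult_left_mono) auto
  finally have u1: "norm (u - 1) \<le> norm u / 10" by simp
  have "norm u \<le> norm (1::'a) + norm (u - 1)" using norm_triangle_sub by blast
  then have "norm u \<le> 1 + norm u / 10" using u1 norm_one_le[where 'a='a] by linarith
  then have "norm (u - 1) \<le> 1/8" using u1 by linarith
  moreover have "v - 1 = (u - 1) - (u - v)" by simp
  ultimately have v1: "norm (v - 1) \<le> 1/4"
    using uv(3) norm_triangle_ineq4[of "u - 1" "u - v"] by simp
  have "d = (v - 1) * (1 - d)" using uv(2) by (simp add: d_def algebra_simps)
  then have "norm d \<le> norm (v - 1) * norm (1 - d)" by (metis norm_mult_ineq)
  also have "\<dots> \<le> 1/4 * 2"
    using v1 norm_triangle_ineq4[of 1 d] norm_one_le[where 'a='a] nd by (intro mult_mono) auto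
  finally show False using nd by simp
qed

lemma norm_power_self_adjoint:
  fixes a :: "'a::unital_cstar_algebra"
  assumes "a \<in> self_adjoint"
  shows "norm (a ^ (2 ^ m)) = norm a ^ (2 ^ m)"
proof (induction m)
  case (Suc m)
  have "star (a ^ n) = a ^ n" for n
    using assms by (induction n) (simp_all add: star_mult self_adjoint_def power_commutes)
  then have "norm (a ^ 2 ^ m * a ^ 2 ^ m) = (norm (a ^ 2 ^ m))\<^sup>2"
    by (metis cstar_identity)
  then show ?case
    using Suc by (simp add: mult_2 power_add power2_eq_square)
qed simp

text \<open>
  By the \<open>C\<^sup>*\<close>-identity, the normalized element \<open>b = a / \<parallel>a\<parallel>\<close> has all its powers with exponent
  \<open>2 ^ m\<close> of norm \<open>1\<close>, so \<open>1 - z b\<close> fails to be invertible for some \<open>z\<close> on the unit circle.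
\<close>

lemma norm_in_spectrum_self_adjoint:
  fixes a :: "'a::unital_cstar_algebra"
  assumes sa: "a \<in> self_adjoint" and "a \<noteq> 0"
  shows "\<exists>z \<in> spectrum a. cmod z = norm a"
proof -
  let ?r = "norm a"
  define b where "b = inverse ?r *\<^sub>R a"
  have r: "?r > 0" using assms by simp
  have b: "b \<in> self_adjoint" "norm b = 1"
    using sa r by (auto simp: b_def self_adjoint_def star_scaleR)
  then have "norm (b ^ (2 ^ m)) = 1" for m by (simp add: norm_power_self_adjoint)
  then obtain z where z: "cmod z = 1" "\<not> has_inverse (1 - z *\<^sub>C b)"
    using not_has_inverse_on_circle[of b] b by blast
  have z0: "z \<noteq> 0" using z(1) by auto
  have "(?r / z) *\<^sub>C (1 - z *\<^sub>C b) = (?r / z) *\<^sub>C 1 - ?r *\<^sub>R b"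
    using z0 by (simp add: scaleC_diff_right scaleC_scaleC scaleC_of_real)
  also have "\<dots> = (?r / z) *\<^sub>C 1 - a" using r by (simp add: b_def)
  finally have "?r / z \<in> spectrum a"
    using has_inverse_scaleC[of "?r / z" "1 - z *\<^sub>C b"] z z0 r by (simp add: in_spectrum_iff)
  then show ?thesis using z by (intro bexI[of _ "?r / z"]) (auto simp: norm_divide)
qed

lemma norm_le_of_spectrum:
  fixes a :: "'a::unital_cstar_algebra"
  assumes sa: "a \<in> self_adjoint" and t: "t \<ge> 0"
    and sp: "\<And>x. complex_of_real x \<in> spectrum a \<Longrightarrow> \<bar>x\<bar> \<le> t"
  shows "norm a \<le> t"
proof (cases "a = 0")
  case False
  then obtain z where z: "z \<in> spectrum a" "cmod z = norm a"
    using norm_in_spectrum_self_adjoint[OF sa] by blast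
  have "z = complex_of_real (Re z)"
    using spectrum_self_adjoint_real[OF sa z(1)] by (simp add: complex_eq_iff)
  then show ?thesis using z sp[of "Re z"] by (metis norm_of_real)
qed (use t in simp)

section \<open>The positive cone and the Cauchy--Schwarz inequality\<close>

lemma self_adjoint_one: "(1 :: 'a::unital_cstar_algebra) \<in> self_adjoint"
  by (simp add: self_adjoint_def)

lemma self_adjoint_add: "a \<in> self_adjoint \<Longrightarrow> b \<in> self_adjoint \<Longrightarrow> a + b \<in> self_adjoint"
  by (simp add: self_adjoint_def star_add)

lemma self_adjoint_diff: "a \<in> self_adjoint \<Longrightarrow> b \<in> self_adjoint \<Longrightarrow> a - b \<in> self_adjoint"
  by (simp add: self_adjoint_def star_diff)

lemma self_adjoint_minus: "a \<in> self_adjoint \<Longrightarrow> - a \<in> self_adjoint"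
  by (simp add: self_adjoint_def star_minus)

lemma self_adjoint_scaleR: "a \<in> self_adjoint \<Longrightarrow> r *\<^sub>R a \<in> self_adjoint"
  by (simp add: self_adjoint_def star_scaleR)

lemma self_adjoint_star_mult: "star a * a \<in> self_adjoint"
  by (simp add: self_adjoint_def star_mult star_star)

lemma self_adjoint_mult_star: "a * star a \<in> self_adjoint"
  by (simp add: self_adjoint_def star_mult star_star)

lemma positive_self_adjoint: "a \<in> positive_cone \<Longrightarrow> a \<in> self_adjoint"
  by (simp add: positive_cone_def)

lemma positive_cone_iff_real_spectrum:
  "a \<in> positive_cone \<longleftrightarrow>
    a \<in> self_adjoint \<and> (\<forall>x. complex_of_real x \<in> spectrum a \<longrightarrow> x \<ge> 0)"
proof (safe)
  fix x assume "a \<in> positive_cone" "complex_of_real x \<in> spectrum a"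
  then show "x \<ge> 0" by (auto simp: positive_cone_def complex_nonneg_Reals_iff)
next
  assume sa: "a \<in> self_adjoint" and *: "\<forall>x. complex_of_real x \<in> spectrum a \<longrightarrow> x \<ge> 0"
  have "z \<in> \<real>\<^sub>\<ge>\<^sub>0" if z: "z \<in> spectrum a" for z
  proof -
    have im: "Im z = 0" by (rule spectrum_self_adjoint_real[OF sa z])
    then have "z = complex_of_real (Re z)" by (simp add: complex_eq_iff)
    then have "Re z \<ge> 0" using * z by metis
    with im show ?thesis by (simp add: complex_nonneg_Reals_iff)
  qed
  then show "a \<in> positive_cone" using sa by (auto simp: positive_cone_def)
qed (auto simp: positive_cone_def)

lemma positive_spectrum_nonneg:
  "a \<in> positive_cone \<Longrightarrow> complex_of_real x \<in> spectrum a \<Longrightarrow> x \<ge> 0"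
  by (simp add: positive_cone_iff_real_spectrum)

lemma real_spectrum_shift:
  "complex_of_real x \<in> spectrum (t *\<^sub>R 1 - a) \<longleftrightarrow> complex_of_real (t - x) \<in> spectrum a"
  using spectrum_shift_real[of "complex_of_real x" t a] by simp

lemma real_spectrum_shift':
  "complex_of_real x \<in> spectrum a \<Longrightarrow> complex_of_real (t - x) \<in> spectrum (t *\<^sub>R 1 - a)"
  by (simp only: real_spectrum_shift diff_diff_eq2 add_diff_cancel_left')

lemma spectrum_real_norm_bound: "complex_of_real x \<in> spectrum a \<Longrightarrow> \<bar>x\<bar> \<le> norm a"
  using spectrum_norm_bound[of "complex_of_real x" a] by simp

text \<open>
  This lemma and the next express positivity by norms only.  That form is visibly stable under sums
  and limits, unlike the definition by the spectrum.
\<close>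

lemma norm_shift_le_if_positive:
  assumes a: "a \<in> positive_cone" and t: "norm a \<le> t"
  shows "norm (t *\<^sub>R 1 - a) \<le> t"
proof (rule norm_le_of_spectrum)
  show "t *\<^sub>R 1 - a \<in> self_adjoint"
    using a by (simp add: positive_self_adjoint self_adjoint_diff self_adjoint_one self_adjoint_scaleR)
  show "t \<ge> 0" using t norm_ge_zero order_trans by blast
  fix x assume "complex_of_real x \<in> spectrum (t *\<^sub>R 1 - a)"
  then have "complex_of_real (t - x) \<in> spectrum a" by (simp only: real_spectrum_shift)
  then have "0 \<le> t - x" "\<bar>t - x\<bar> \<le> norm a"
    using positive_spectrum_nonneg[OF a] spectrum_real_norm_bound by blast+
  then show "\<bar>x\<bar> \<le> t" using t by linarith
qed

lemma positive_if_norm_shift_le: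
  assumes sa: "a \<in> self_adjoint" and n: "norm (t *\<^sub>R 1 - a) \<le> t"
  shows "a \<in> positive_cone"
  unfolding positive_cone_iff_real_spectrum
proof (intro conjI allI impI sa)
  fix x assume "complex_of_real x \<in> spectrum a"
  then have "complex_of_real (t - x) \<in> spectrum (t *\<^sub>R 1 - a)" by (rule real_spectrum_shift')
  then show "x \<ge> 0" using n spectrum_real_norm_bound by fastforce
qed

lemma positive_add:
  assumes "a \<in> positive_cone" "b \<in> positive_cone"
  shows "a + b \<in> positive_cone"
proof (rule positive_if_norm_shift_le)
  show "a + b \<in> self_adjoint" using assms by (simp add: positive_self_adjoint self_adjoint_add)
  have "(norm a + norm b) *\<^sub>R 1 - (a + b) = (norm a *\<^sub>R 1 - a) + (norm b *\<^sub>R 1 - b)"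
    by (simp add: algebra_simps)
  show "norm ((norm a + norm b) *\<^sub>R 1 - (a + b)) \<le> norm a + norm b"
    unfolding \<open>(norm a + norm b) *\<^sub>R 1 - (a + b) = (norm a *\<^sub>R 1 - a) + (norm b *\<^sub>R 1 - b)\<close>
    using norm_triangle_ineq[of "norm a *\<^sub>R 1 - a" "norm b *\<^sub>R 1 - b"]
      norm_shift_le_if_positive[OF assms(1) order_refl]
      norm_shift_le_if_positive[OF assms(2) order_refl] by linarith
qed

lemma positive_scaleR:
  assumes "a \<in> positive_cone" "r \<ge> 0"
  shows "r *\<^sub>R a \<in> positive_cone"
proof (rule positive_if_norm_shift_le)
  show "r *\<^sub>R a \<in> self_adjoint" using assms by (simp add: positive_self_adjoint self_adjoint_scaleR)
  have "(r * norm a) *\<^sub>R 1 - r *\<^sub>R a = r *\<^sub>R (norm a *\<^sub>R 1 - a)"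
    by (simp add: algebra_simps)
  then show "norm ((r * norm a) *\<^sub>R 1 - r *\<^sub>R a) \<le> r * norm a"
    using norm_shift_le_if_positive[OF assms(1) order_refl] assms(2)
    by (simp add: mult_left_mono)
qed

lemma positive_limit:
  fixes s :: "nat \<Rightarrow> 'a::unital_cstar_algebra"
  assumes pos: "\<And>n. s n \<in> positive_cone" and lim: "s \<longlonglongrightarrow> a"
  shows "a \<in> positive_cone"
proof (rule positive_if_norm_shift_le)
  have "(\<lambda>n. star (s n)) \<longlonglongrightarrow> star a" by (rule tendsto_star[OF lim])
  moreover have "star (s n) = s n" for n
    using positive_self_adjoint[OF pos[of n]] by (simp add: self_adjoint_def)
  ultimately show "a \<in> self_adjoint"
    using lim LIMSEQ_unique by (auto simp: self_adjoint_def)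
  show "norm (norm a *\<^sub>R 1 - a) \<le> norm a"
  proof (rule LIMSEQ_le)
    show "(\<lambda>n. norm (norm (s n) *\<^sub>R 1 - s n)) \<longlonglongrightarrow> norm (norm a *\<^sub>R 1 - a)"
      by (intro tendsto_intros lim)
    show "(\<lambda>n. norm (s n)) \<longlonglongrightarrow> norm a" by (intro tendsto_intros lim)
    show "\<exists>N. \<forall>n\<ge>N. norm (norm (s n) *\<^sub>R 1 - s n) \<le> norm (s n)"
      using norm_shift_le_if_positive[OF pos order_refl] by blast
  qed
qed

lemma norm_shift_positive:
  assumes "a \<in> self_adjoint" "norm a \<le> t"
  shows "t *\<^sub>R 1 - a \<in> positive_cone" "t *\<^sub>R 1 + a \<in> positive_cone"
proof -
  have "b \<in> self_adjoint \<Longrightarrow> norm b \<le> t \<Longrightarrow> t *\<^sub>R 1 - b \<in> positive_cone" for b :: 'a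
    by (rule positive_if_norm_shift_le[of _ t])
      (simp_all add: self_adjoint_diff self_adjoint_one self_adjoint_scaleR)
  from this[of a] this[of "- a"] assms
  show "t *\<^sub>R 1 - a \<in> positive_cone" "t *\<^sub>R 1 + a \<in> positive_cone"
    by (simp_all add: self_adjoint_minus)
qed

text \<open>
  The bounds \<open>- t \<le> a \<le> t\<close> confine the spectrum to \<open>[- t, t]\<close>, and the spectral radius of a
  self-adjoint element is its norm.
\<close>

lemma norm_le_if_between:
  fixes a :: "'a::unital_cstar_algebra"
  assumes "t *\<^sub>R 1 - a \<in> positive_cone" "t *\<^sub>R 1 + a \<in> positive_cone" "t \<ge> 0"
  shows "norm a \<le> t"
proof (rule norm_le_of_spectrum)
  have "a = t *\<^sub>R 1 - (t *\<^sub>R 1 - a)" by simp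
  then show "a \<in> self_adjoint"
    using assms(1) by (metis positive_self_adjoint self_adjoint_diff self_adjoint_one
        self_adjoint_scaleR)
  show "\<bar>x\<bar> \<le> t" if x: "complex_of_real x \<in> spectrum a" for x
  proof -
    have "complex_of_real (t - x) \<in> spectrum (t *\<^sub>R 1 - a)" using x by (rule real_spectrum_shift')
    moreover have "complex_of_real (t + x) \<in> spectrum (t *\<^sub>R 1 + a)"
    proof -
      have "complex_of_real (- x) \<in> spectrum (- a)"
        using x real_spectrum_shift[of "- x" 0 a] by simp
      then show ?thesis using real_spectrum_shift[of "t + x" t "- a"] by simp
    qed
    ultimately have "t - x \<ge> 0" "t + x \<ge> 0"
      using assms positive_spectrum_nonneg by blast+
    then show ?thesis by linarith
  qed
qed (rule assms(3))

text \<open>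
  For \<open>x < 0\<close> the factorization \<open>x - h\<^sup>2 = (w - h) (w + h)\<close> with \<open>w = \<i> \<surd>(- x)\<close> has
  invertible factors, since the spectrum of \<open>h\<close> is real.
\<close>

lemma positive_square:
  fixes h :: "'a::unital_cstar_algebra"
  assumes h: "h \<in> self_adjoint"
  shows "h * h \<in> positive_cone"
  unfolding positive_cone_iff_real_spectrum
proof (intro conjI allI impI)
  show "h * h \<in> self_adjoint" using h by (simp add: self_adjoint_def star_mult)
  fix x assume x: "complex_of_real x \<in> spectrum (h * h)"
  show "x \<ge> 0"
  proof (rule ccontr)
    assume neg: "\<not> x \<ge> 0"
    define w where "w = \<i> * complex_of_real (sqrt (- x))"
    have w2: "w * w = complex_of_real x"
    proof -
      have "w * w = - complex_of_real (sqrt (- x) * sqrt (- x))"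
        unfolding w_def of_real_mult by (simp add: algebra_simps)
      also have "sqrt (- x) * sqrt (- x) = - x" using neg by simp
      finally show ?thesis by simp
    qed
    have im: "Im w \<noteq> 0" "Im (- w) \<noteq> 0" using neg by (auto simp: w_def)
    then have "has_inverse (w *\<^sub>C 1 - h)" "has_inverse ((- w) *\<^sub>C 1 - h)"
      using spectrum_self_adjoint_real[OF h] by (auto simp only: in_spectrum_iff)
    then have "has_inverse ((w *\<^sub>C 1 - h) * (- ((- w) *\<^sub>C 1 - h)))"
      by (simp only: has_inverse_mult has_inverse_minus)
    moreover have "(w *\<^sub>C 1 - h) * (- ((- w) *\<^sub>C 1 - h)) = complex_of_real x *\<^sub>C 1 - h * h"
      by (simp add: algebra_simps scaleC_minus_left mult_scaleC_left mult_scaleC_right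
          scaleC_scaleC w2 scaleC_diff_right scaleC_add_right)
    ultimately show False using x by (simp add: in_spectrum_iff)
  qed
qed

text \<open>
  The sum is half of \<open>u\<^sup>2 + v\<^sup>2\<close>, where \<open>u\<close> and \<open>v\<close> are twice the self-adjoint real and
  imaginary parts of \<open>b\<close>, up to sign.
\<close>

lemma star_mult_add_mult_star_positive:
  fixes b :: "'a::unital_cstar_algebra"
  shows "star b * b + b * star b \<in> positive_cone"
proof -
  define u where "u = b + star b"
  define v where "v = \<i> *\<^sub>C (b - star b)"
  have u: "u \<in> self_adjoint" by (simp add: u_def self_adjoint_def star_add star_star add.commute)
  have v: "v \<in> self_adjoint"
    by (simp add: v_def self_adjoint_def star_diff star_scaleC star_star scaleC_minus_left
        scaleC_diff_right)
  have "u * u + v * v = 2 *\<^sub>R (star b * b + b * star b)"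
    by (simp add: u_def v_def mult_scaleC_left mult_scaleC_right scaleC_scaleC scaleC_minus_left
        scaleC_diff_right algebra_simps scaleR_2)
  then have "star b * b + b * star b = (1/2) *\<^sub>R (u * u + v * v)" by simp
  also have "\<dots> \<in> positive_cone"
    by (intro positive_scaleR positive_add positive_square u v) simp
  finally show ?thesis .
qed

text \<open>
  With \<open>t = \<parallel>p\<parallel>\<close>, the upper bound \<open>b\<^sup>* b \<le> t\<close> passes to \<open>b b\<^sup>*\<close>, because the two products have
  the same nonzero spectrum.  As \<open>b\<^sup>* b + b b\<^sup>* \<ge> 0\<close>, this gives the lower bound
  \<open>b\<^sup>* b \<ge> - b b\<^sup>* \<ge> - t\<close>, so \<open>\<parallel>b\<^sup>* b\<parallel> \<le> t\<close>.
\<close>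

lemma norm_square_le_if_dominated:
  fixes b p :: "'a::unital_cstar_algebra"
  assumes dom: "p - star b * b \<in> positive_cone"
  shows "(norm b)\<^sup>2 \<le> norm p"
proof -
  let ?t = "norm p"
  have "p = (p - star b * b) + star b * b" by simp
  then have p: "p \<in> self_adjoint"
    using dom by (metis positive_self_adjoint self_adjoint_add self_adjoint_star_mult)
  have up: "?t *\<^sub>R 1 - star b * b \<in> positive_cone"
    using positive_add[OF norm_shift_positive(1)[OF p order_refl] dom] by simp
  have up': "?t *\<^sub>R 1 - b * star b \<in> positive_cone"
    unfolding positive_cone_iff_real_spectrum
  proof (intro conjI allI impI)
    show "?t *\<^sub>R 1 - b * star b \<in> self_adjoint"
      by (simp add: self_adjoint_diff self_adjoint_mult_star self_adjoint_one self_adjoint_scaleR)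
    fix x assume x: "complex_of_real x \<in> spectrum (?t *\<^sub>R 1 - b * star b)"
    show "x \<ge> 0"
    proof (cases "x = ?t")
      case False
      have "complex_of_real (?t - x) \<in> spectrum (b * star b)"
        using x by (simp only: real_spectrum_shift)
      then have "complex_of_real (?t - x) \<in> spectrum (star b * b)"
        by (rule spectrum_mult_commute) (use False in simp)
      then have "complex_of_real x \<in> spectrum (?t *\<^sub>R 1 - star b * b)"
        by (simp only: real_spectrum_shift)
      with up show ?thesis by (rule positive_spectrum_nonneg)
    qed simp
  qed
  have "?t *\<^sub>R 1 + star b * b \<in> positive_cone"
    using positive_add[OF up' star_mult_add_mult_star_positive[of b]] by (simp add: algebra_simps)
  then have "norm (star b * b) \<le> ?t"
    using up by (intro norm_le_if_between) auto
  then show ?thesis by (simp add: cstar_identity)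
qed

text \<open>
  The Cauchy--Schwarz inequality for \<open>p = \<langle>x, x\<rangle>\<close>, \<open>q = \<langle>y, y\<rangle>\<close> and \<open>b = \<langle>y, x\<rangle>\<close>, where the
  hypothesis is the positivity of \<open>\<langle>x + y a, x + y a\<rangle>\<close>.  The choice \<open>a = - t b\<close> gives
  \<open>2 t b\<^sup>* b \<le> p + t\<^sup>2 b\<^sup>* q b\<close>, and \<open>t = 1 / \<parallel>q\<parallel>\<close> is the best parameter.
\<close>

lemma Cauchy_Schwarz:
  fixes b p q :: "'a::unital_cstar_algebra"
  assumes pos: "\<And>a. p + star b * a + star a * b + star a * q * a \<in> positive_cone"
  shows "(norm b)\<^sup>2 \<le> norm p * norm q"
proof -
  have bound: "2 * t * (norm b)\<^sup>2 \<le> norm p + t\<^sup>2 * (norm b)\<^sup>2 * norm q" if t: "t \<ge> 0" for t :: real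
  proof -
    let ?P = "p + t\<^sup>2 *\<^sub>R (star b * q * b)" and ?c = "sqrt (2 * t) *\<^sub>R b"
    have c: "star ?c * ?c = (2 * t) *\<^sub>R (star b * b)"
    proof -
      have "star ?c * ?c = (sqrt (2 * t) * sqrt (2 * t)) *\<^sub>R (star b * b)"
        by (simp only: star_scaleR mult_scaleR_left mult_scaleR_right scaleR_scaleR)
      also have "sqrt (2 * t) * sqrt (2 * t) = 2 * t" using t by simp
      finally show ?thesis .
    qed
    have "p + star b * (- t *\<^sub>R b) + star (- t *\<^sub>R b) * b + star (- t *\<^sub>R b) * q * (- t *\<^sub>R b)
      = ?P - (t *\<^sub>R (star b * b) + t *\<^sub>R (star b * b))"
      by (simp add: star_scaleR star_minus power2_eq_square algebra_simps)
    also have "\<dots> = ?P - star ?c * ?c"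
      unfolding c by (simp only: mult_2 scaleR_add_left)
    finally have "?P - star ?c * ?c \<in> positive_cone" using pos[of "- t *\<^sub>R b"] by metis
    then have "(norm ?c)\<^sup>2 \<le> norm ?P" by (rule norm_square_le_if_dominated)
    also have "\<dots> \<le> norm p + norm (t\<^sup>2 *\<^sub>R (star b * q * b))" by (rule norm_triangle_ineq)
    also have "norm (star b * q * b) \<le> norm (star b) * norm q * norm b"
      by (meson mult_right_mono norm_ge_zero norm_mult_ineq order_trans)
    then have "norm (t\<^sup>2 *\<^sub>R (star b * q * b)) \<le> t\<^sup>2 * (norm b * norm q * norm b)"
      by (simp add: mult_left_mono)
    finally have "(norm ?c)\<^sup>2 \<le> norm p + t\<^sup>2 * (norm b * norm q * norm b)" by simp
    moreover have "(norm ?c)\<^sup>2 = 2 * t * (norm b)\<^sup>2"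
      using t by (simp add: power_mult_distrib)
    moreover have "t\<^sup>2 * (norm b * norm q * norm b) = t\<^sup>2 * (norm b)\<^sup>2 * norm q"
      by (simp add: power2_eq_square)
    ultimately show ?thesis by linarith
  qed
  show ?thesis
  proof (cases "norm q = 0")
    case True
    have "(norm b)\<^sup>2 \<le> 0"
    proof (rule ccontr)
      assume "\<not> ?thesis"
      then have b: "(norm b)\<^sup>2 > 0" by simp
      then show False using bound[of "(norm p + 1) / (norm b)\<^sup>2"] True norm_ge_zero[of p]
        by simp
    qed
    then show ?thesis using True by simp
  next
    case False
    then have q: "norm q > 0" by simp
    have "2 * (norm b)\<^sup>2 / norm q \<le> norm p + (norm b)\<^sup>2 / norm q"
      using bound[of "1 / norm q"] q by (simp add: power2_eq_square)
    then have "(norm b)\<^sup>2 / norm q \<le> norm p" by simp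
    then show ?thesis using q by (simp add: divide_le_eq)
  qed
qed

section \<open>The center and automorphisms\<close>

lemma centerI: "(\<And>a. z * a = a * z) \<Longrightarrow> z \<in> algebra_center"
  unfolding algebra_center_def by (rule CollectI) (rule allI)

lemma centerD: "z \<in> algebra_center \<Longrightarrow> z * a = a * z"
  unfolding algebra_center_def by (drule CollectD) (rule spec)

lemma center_add: "z \<in> algebra_center \<Longrightarrow> w \<in> algebra_center \<Longrightarrow> z + w \<in> algebra_center"
  by (rule centerI) (simp only: distrib_left distrib_right centerD)

lemma center_diff: "z \<in> algebra_center \<Longrightarrow> w \<in> algebra_center \<Longrightarrow> z - w \<in> algebra_center"
  by (rule centerI) (simp only: left_diff_distrib right_diff_distrib centerD)

lemma center_scaleR: "z \<in> algebra_center \<Longrightarrow> r *\<^sub>R z \<in> algebra_center"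
  by (rule centerI) (simp only: mult_scaleR_left mult_scaleR_right centerD)

context
  fixes f :: "'a::unital_cstar_algebra \<Rightarrow> 'a"
  assumes f: "cstar_automorphism f"
begin

lemma cstar_automorphism_add: "f (x + y) = f x + f y"
  and cstar_automorphism_scaleC: "f (z *\<^sub>C x) = z *\<^sub>C f x"
  and cstar_automorphism_mult: "f (x * y) = f x * f y"
  and cstar_automorphism_star: "f (star x) = star (f x)"
  using f unfolding cstar_automorphism_def by blast+

lemma cstar_automorphism_scaleR: "f (r *\<^sub>R x) = r *\<^sub>R f x"
  by (simp add: cstar_automorphism_scaleC flip: scaleC_of_real)

lemma cstar_automorphism_zero: "f 0 = 0"
  using cstar_automorphism_add[of 0 0] by simp

lemma cstar_automorphism_minus: "f (- x) = - f x"
  using cstar_automorphism_scaleR[of "-1" x] by simp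

lemma cstar_automorphism_diff: "f (x - y) = f x - f y"
  using cstar_automorphism_add[of x "- y"] by (simp add: cstar_automorphism_minus)

lemma cstar_automorphism_preimage: "\<exists>x. f x = y"
  using f unfolding cstar_automorphism_def by (metis bij_is_surj surjD)

lemma cstar_automorphism_one: "f 1 = 1"
proof -
  obtain e where "f e = 1" using cstar_automorphism_preimage by blast
  then show ?thesis using cstar_automorphism_mult[of e 1] by simp
qed

lemma cstar_automorphism_spectrum:
  assumes "z \<in> spectrum (f a)"
  shows "z \<in> spectrum a"
proof (rule ccontr)
  assume "z \<notin> spectrum a"
  then obtain c where c: "c * (z *\<^sub>C 1 - a) = 1" "(z *\<^sub>C 1 - a) * c = 1"
    by (auto simp: in_spectrum_iff has_inverse_def)
  have "f c * (z *\<^sub>C 1 - f a) = 1 \<and> (z *\<^sub>C 1 - f a) * f c = 1"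
    using arg_cong[OF c(1), of f] arg_cong[OF c(2), of f]
    by (simp add: cstar_automorphism_mult cstar_automorphism_diff cstar_automorphism_scaleC
        cstar_automorphism_one)
  then show False using assms by (auto simp: in_spectrum_iff has_inverse_def)
qed

lemma cstar_automorphism_self_adjoint: "a \<in> self_adjoint \<Longrightarrow> f a \<in> self_adjoint"
  by (simp add: self_adjoint_def flip: cstar_automorphism_star)

text \<open>
  An automorphism does not enlarge spectra, hence it does not increase norms of self-adjoint elements;
  the \<open>C\<^sup>*\<close>-identity reduces the general case to \<open>a\<^sup>* a\<close>.
\<close>

lemma cstar_automorphism_norm_le: "norm (f a) \<le> norm a"
proof -
  have "norm (f (star a * a)) \<le> norm (star a * a)"
    by (intro norm_le_of_spectrum cstar_automorphism_self_adjoint self_adjoint_star_mult norm_ge_zero)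
      (blast intro: spectrum_real_norm_bound cstar_automorphism_spectrum)
  then have "(norm (f a))\<^sup>2 \<le> (norm a)\<^sup>2"
    by (simp add: cstar_automorphism_mult cstar_automorphism_star cstar_identity)
  then show ?thesis by (rule power2_le_imp_le) simp
qed

lemma cstar_automorphism_tendsto:
  assumes "(s \<longlongrightarrow> l) F"
  shows "((\<lambda>x. f (s x)) \<longlongrightarrow> f l) F"
proof (rule LIM_zero_cancel, rule Lim_null_comparison)
  show "\<forall>\<^sub>F x in F. norm (f (s x) - f l) \<le> norm (s x - l)"
    by (intro always_eventually allI)
      (simp add: cstar_automorphism_norm_le flip: cstar_automorphism_diff)
  show "((\<lambda>x. norm (s x - l)) \<longlongrightarrow> 0) F"
    using assms by (simp add: tendsto_norm_zero LIM_zero)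
qed

lemma cstar_automorphism_center:
  assumes "a \<in> algebra_center"
  shows "f a \<in> algebra_center"
proof (rule centerI)
  fix b
  obtain c where c: "b = f c" using cstar_automorphism_preimage by metis
  have "f (a * c) = f (c * a)" using centerD[OF assms, of c] by (rule arg_cong)
  then show "f a * b = b * f a" by (simp only: c cstar_automorphism_mult)
qed

end

section \<open>The Hilbert module of a positive definite kernel\<close>

locale positive_kernel =
  fixes K :: "'s \<Rightarrow> 's \<Rightarrow> 'a::unital_cstar_algebra"
  assumes kernel_star: "star (K s t) = K t s"
    and kernel_positive:
      "\<And>(n::nat) g b. (\<Sum>i<n. \<Sum>j<n. star (b i) * K (g i) (g j) * b j) \<in> positive_cone"
begin

text \<open>
  A list of pairs \<open>(t, b)\<close> stands for the formal sum of the \<open>k\<^sub>t b\<close>.  It represents the function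
  \<open>combination\<close>, and \<open>pairing xs f\<close> is the inner product of this function with \<open>f\<close>, as dictated
  by the reproducing property \<open>f s = \<langle>k\<^sub>s, f\<rangle>\<close>.
\<close>

definition combination :: "('s \<times> 'a) list \<Rightarrow> 's \<Rightarrow> 'a" where
  "combination xs s = (\<Sum>(t, b)\<leftarrow>xs. K s t * b)"

definition pairing :: "('s \<times> 'a) list \<Rightarrow> ('s \<Rightarrow> 'a) \<Rightarrow> 'a" where
  "pairing xs f = (\<Sum>(s, b)\<leftarrow>xs. star b * f s)"

definition gram :: "('s \<times> 'a) list \<Rightarrow> ('s \<times> 'a) list \<Rightarrow> 'a" where
  "gram xs ys = pairing xs (combination ys)"

definition right_mult :: "('s \<times> 'a) list \<Rightarrow> 'a \<Rightarrow> ('s \<times> 'a) list" where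
  "right_mult xs a = map (\<lambda>(s, b). (s, b * a)) xs"

definition difference :: "('s \<times> 'a) list \<Rightarrow> ('s \<times> 'a) list \<Rightarrow> ('s \<times> 'a) list" where
  "difference xs ys = xs @ right_mult ys (- 1)"

definition seminorm :: "('s \<times> 'a) list \<Rightarrow> real" where
  "seminorm xs = sqrt (norm (gram xs xs))"

lemma combination_Nil [simp]: "combination [] s = 0"
  and combination_Cons [simp]: "combination ((t, b) # xs) s = K s t * b + combination xs s"
  and combination_append [simp]: "combination (xs @ ys) s = combination xs s + combination ys s"
  by (simp_all add: combination_def)

lemma combination_right_mult [simp]: "combination (right_mult xs a) s = combination xs s * a"
  by (induction xs) (auto simp: right_mult_def distrib_right mult.assoc)

lemma combination_difference [simp]:
  "combination (difference xs ys) s = combination xs s - combination ys s"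
  by (simp add: difference_def)

lemma pairing_Nil [simp]: "pairing [] f = 0"
  and pairing_Cons [simp]: "pairing ((s, b) # xs) f = star b * f s + pairing xs f"
  and pairing_append [simp]: "pairing (xs @ ys) f = pairing xs f + pairing ys f"
  by (simp_all add: pairing_def)

lemma pairing_right_mult [simp]: "pairing (right_mult xs a) f = star a * pairing xs f"
  by (induction xs) (auto simp: right_mult_def distrib_left mult.assoc star_mult)

lemma pairing_add: "pairing xs (\<lambda>s. f s + h s) = pairing xs f + pairing xs h"
  by (induction xs) (auto simp: distrib_left)

lemma pairing_mult: "pairing xs (\<lambda>s. f s * a) = pairing xs f * a"
  by (induction xs) (auto simp: distrib_right mult.assoc)

lemma pairing_zero [simp]: "pairing xs (\<lambda>s. 0) = 0"
  by (induction xs) auto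

lemma pairing_tendsto:
  assumes "\<And>s. (\<lambda>n. F n s) \<longlonglongrightarrow> f s"
  shows "(\<lambda>n. pairing xs (F n)) \<longlonglongrightarrow> pairing xs f"
  by (induction xs) (auto intro!: tendsto_intros assms)

lemma gram_append_left: "gram (xs @ ys) zs = gram xs zs + gram ys zs"
  by (simp add: gram_def)

lemma gram_right_mult_left: "gram (right_mult xs a) ys = star a * gram xs ys"
  by (simp add: gram_def)

lemma gram_append_right: "gram zs (xs @ ys) = gram zs xs + gram zs ys"
proof -
  have "combination (xs @ ys) = (\<lambda>s. combination xs s + combination ys s)" by auto
  then show ?thesis by (simp add: gram_def pairing_add)
qed

lemma gram_right_mult_right: "gram xs (right_mult ys a) = gram xs ys * a"
proof -
  have "combination (right_mult ys a) = (\<lambda>s. combination ys s * a)" by auto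
  then show ?thesis by (simp add: gram_def pairing_mult)
qed

lemma gram_difference_left: "gram (difference xs ys) zs = gram xs zs - gram ys zs"
  by (simp add: difference_def gram_append_left gram_right_mult_left star_minus)

lemma gram_difference_right: "gram zs (difference xs ys) = gram zs xs - gram zs ys"
  by (simp add: difference_def gram_append_right gram_right_mult_right)

lemma star_pairing_kernel: "star (pairing xs (\<lambda>s. K s t)) = combination xs t"
  by (induction xs) (auto simp: star_add star_mult star_star kernel_star)

lemma gram_Cons_right: "gram xs ((t, b) # ys) = pairing xs (\<lambda>s. K s t) * b + gram xs ys"
proof -
  have "combination ((t, b) # ys) = (\<lambda>s. K s t * b + combination ys s)" by auto
  then show ?thesis by (simp add: gram_def pairing_add pairing_mult)
qed

lemma star_gram: "star (gram xs ys) = gram ys xs"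
proof (induction ys)
  case Nil
  then show ?case by (simp add: gram_def combination_def[abs_def])
next
  case (Cons y ys)
  obtain t b where y: "y = (t, b)" by (cases y)
  show ?case
    using Cons by (simp add: y gram_Cons_right star_add star_mult star_pairing_kernel)
      (simp add: gram_def)
qed

lemma gram_positive: "gram xs xs \<in> positive_cone"
proof -
  have comb: "combination xs s = (\<Sum>j<length xs. K s (fst (xs ! j)) * snd (xs ! j))" for s
    by (simp add: combination_def sum_list_sum_nth atLeast0LessThan case_prod_beta)
  have "gram xs xs = (\<Sum>i<length xs. \<Sum>j<length xs.
      star (snd (xs ! i)) * K (fst (xs ! i)) (fst (xs ! j)) * snd (xs ! j))"
    by (simp add: gram_def pairing_def sum_list_sum_nth atLeast0LessThan case_prod_beta comb
        sum_distrib_left mult.assoc)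
  then show ?thesis
    using kernel_positive[of "\<lambda>i. snd (xs ! i)" "\<lambda>i. fst (xs ! i)" "length xs"] by simp
qed

text \<open>
  The Gram form descends from formal sums to the functions they represent: in the second argument by
  definition, in the first by the hermitian symmetry.
\<close>

lemma gram_cong:
  assumes "combination xs = combination xs'" "combination ys = combination ys'"
  shows "gram xs ys = gram xs' ys'"
proof -
  have "gram xs ys = gram xs ys'" using assms(2) by (simp add: gram_def)
  also have "\<dots> = star (gram ys' xs)" by (simp add: star_gram)
  also have "\<dots> = star (gram ys' xs')" using assms(1) by (simp add: gram_def)
  finally show ?thesis by (simp add: star_gram)
qed

lemma seminorm_cong: "combination xs = combination ys \<Longrightarrow> seminorm xs = seminorm ys"
  using gram_cong[of xs ys xs ys] by (simp add: seminorm_def)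

lemma seminorm_nonneg [simp]: "seminorm xs \<ge> 0"
  by (simp add: seminorm_def)

lemma seminorm_square: "(seminorm xs)\<^sup>2 = norm (gram xs xs)"
  by (simp add: seminorm_def)

lemma norm_gram_le: "norm (gram xs ys) \<le> seminorm xs * seminorm ys"
proof (rule power2_le_imp_le)
  have "gram ys ys + star (gram xs ys) * a + star a * gram xs ys + star a * gram xs xs * a
      = gram (ys @ right_mult xs a) (ys @ right_mult xs a)" for a
    by (simp add: gram_append_left gram_append_right gram_right_mult_left gram_right_mult_right
        star_gram algebra_simps)
  then have "(norm (gram xs ys))\<^sup>2 \<le> norm (gram ys ys) * norm (gram xs xs)"
    by (intro Cauchy_Schwarz) (simp add: gram_positive)
  then show "(norm (gram xs ys))\<^sup>2 \<le> (seminorm xs * seminorm ys)\<^sup>2"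
    by (simp add: power_mult_distrib seminorm_square mult.commute)
qed simp

lemma seminorm_append_le: "seminorm (xs @ ys) \<le> seminorm xs + seminorm ys"
proof (rule power2_le_imp_le)
  have "(seminorm (xs @ ys))\<^sup>2 = norm ((gram xs xs + gram ys ys) + (gram xs ys + gram ys xs))"
    unfolding seminorm_square
    by (simp add: gram_append_left gram_append_right algebra_simps)
  also have "\<dots> \<le> (norm (gram xs xs) + norm (gram ys ys)) + (norm (gram xs ys) + norm (gram ys xs))"
    by (intro order_trans[OF norm_triangle_ineq] add_mono norm_triangle_ineq)
  also have "\<dots> \<le> ((seminorm xs)\<^sup>2 + (seminorm ys)\<^sup>2) + (seminorm xs * seminorm ys + seminorm ys * seminorm xs)"
    unfolding seminorm_square by (intro add_mono norm_gram_le order_refl)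
  finally show "(seminorm (xs @ ys))\<^sup>2 \<le> (seminorm xs + seminorm ys)\<^sup>2"
    by (simp add: power2_sum)
qed simp

lemma seminorm_right_mult_le: "seminorm (right_mult xs a) \<le> seminorm xs * norm a"
proof (rule power2_le_imp_le)
  have "norm (star a * gram xs xs * a) \<le> norm (star a) * norm (gram xs xs) * norm a"
    by (meson mult_right_mono norm_ge_zero norm_mult_ineq order_trans)
  then show "(seminorm (right_mult xs a))\<^sup>2 \<le> (seminorm xs * norm a)\<^sup>2"
    by (simp add: power_mult_distrib seminorm_square gram_right_mult_left gram_right_mult_right
        mult.assoc power2_eq_square[of "norm a"] mult.left_commute)
qed simp

lemma seminorm_difference_commute: "seminorm (difference xs ys) = seminorm (difference ys xs)"
proof -
  have "gram (difference xs ys) (difference xs ys) = gram (difference ys xs) (difference ys xs)"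
    by (simp add: gram_difference_left gram_difference_right)
  then show ?thesis by (simp add: seminorm_def)
qed

lemma seminorm_difference_triangle:
  "seminorm (difference xs zs) \<le> seminorm (difference xs ys) + seminorm (difference ys zs)"
proof -
  have "seminorm (difference xs zs) = seminorm (difference xs ys @ difference ys zs)"
    by (rule seminorm_cong) auto
  then show ?thesis using seminorm_append_le by simp
qed

lemma seminorm_difference_self [simp]: "seminorm (difference xs xs) = 0"
  by (simp add: seminorm_def gram_difference_left)

lemma seminorm_le_difference: "seminorm xs \<le> seminorm ys + seminorm (difference xs ys)"
proof -
  have "seminorm xs = seminorm (ys @ difference xs ys)" by (rule seminorm_cong) auto
  then show ?thesis using seminorm_append_le by simp
qed

lemma combination_eq_gram: "combination xs s = gram [(s, 1)] xs"
  by (simp add: gram_def)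

lemma norm_combination_le: "norm (combination xs s) \<le> seminorm [(s, 1)] * seminorm xs"
  unfolding combination_eq_gram by (rule norm_gram_le)

lemma norm_gram_diff_le:
  "norm (gram xs ys - gram xs' ys') \<le>
    seminorm (difference xs xs') * seminorm ys + seminorm xs' * seminorm (difference ys ys')"
proof -
  have "gram xs ys - gram xs' ys' = gram (difference xs xs') ys + gram xs' (difference ys ys')"
    by (simp add: gram_difference_left gram_difference_right)
  then show ?thesis
    using norm_triangle_ineq[of "gram (difference xs xs') ys" "gram xs' (difference ys ys')"]
      norm_gram_le[of "difference xs xs'" ys] norm_gram_le[of xs' "difference ys ys'"] by simp
qed

subsection \<open>Completion inside the functions\<close>

definition seminorm_Cauchy :: "(nat \<Rightarrow> ('s \<times> 'a) list) \<Rightarrow> bool" where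
  "seminorm_Cauchy X \<longleftrightarrow>
    (\<forall>e>0. \<exists>M. \<forall>m\<ge>M. \<forall>n\<ge>M. seminorm (difference (X m) (X n)) < e)"

definition approximates :: "(nat \<Rightarrow> ('s \<times> 'a) list) \<Rightarrow> ('s \<Rightarrow> 'a) \<Rightarrow> bool" where
  "approximates X f \<longleftrightarrow> seminorm_Cauchy X \<and> (\<forall>s. (\<lambda>n. combination (X n) s) \<longlonglongrightarrow> f s)"

definition kernel_space :: "('s \<Rightarrow> 'a) set" where
  "kernel_space = {f. \<exists>X. approximates X f}"

text \<open>
  The limit exists and does not depend on the chosen approximating sequences, by
  \<open>gram_convergent\<close> and \<open>gram_diff_tendsto_zero\<close>; see \<open>kernel_inner_tendsto\<close>.
\<close>

definition kernel_inner :: "('s \<Rightarrow> 'a) \<Rightarrow> ('s \<Rightarrow> 'a) \<Rightarrow> 'a" where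
  "kernel_inner f h = lim (\<lambda>n. gram ((SOME X. approximates X f) n) ((SOME Y. approximates Y h) n))"

definition fnorm :: "('s \<Rightarrow> 'a) \<Rightarrow> real" where
  "fnorm f = sqrt (norm (kernel_inner f f))"

lemma seminorm_Cauchy_if_dominated:
  assumes X: "seminorm_Cauchy X" and c: "c \<ge> 0"
    and le: "\<And>m n. seminorm (difference (Y m) (Y n)) \<le> c * seminorm (difference (X m) (X n))"
  shows "seminorm_Cauchy Y"
  unfolding seminorm_Cauchy_def
proof (intro allI impI)
  fix e :: real assume "e > 0"
  then have "e / (c + 1) > 0" using c by simp
  then obtain M where M: "\<And>m n. m \<ge> M \<Longrightarrow> n \<ge> M \<Longrightarrow> seminorm (difference (X m) (X n)) < e / (c + 1)"
    using X unfolding seminorm_Cauchy_def by metis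
  have "seminorm (difference (Y m) (Y n)) < e" if "m \<ge> M" "n \<ge> M" for m n
  proof -
    have "seminorm (difference (Y m) (Y n)) \<le> (c + 1) * seminorm (difference (X m) (X n))"
      using le[of m n] mult_right_mono[of c "c + 1" "seminorm (difference (X m) (X n))"] by simp
    also have "\<dots> < (c + 1) * (e / (c + 1))"
      using M[OF that] c by (intro mult_strict_left_mono) auto
    finally show ?thesis using c by simp
  qed
  then show "\<exists>M. \<forall>m\<ge>M. \<forall>n\<ge>M. seminorm (difference (Y m) (Y n)) < e" by blast
qed

lemma approximates_append:
  assumes X: "approximates X f" and Y: "approximates Y h"
  shows "approximates (\<lambda>n. X n @ Y n) (\<lambda>s. f s + h s)"
  unfolding approximates_def
proof
  show "seminorm_Cauchy (\<lambda>n. X n @ Y n)"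
    unfolding seminorm_Cauchy_def
  proof (intro allI impI)
    fix e :: real assume "e > 0"
    then have e: "e / 2 > 0" by simp
    obtain M where M: "\<And>m n. m \<ge> M \<Longrightarrow> n \<ge> M \<Longrightarrow> seminorm (difference (X m) (X n)) < e / 2"
      using X e unfolding approximates_def seminorm_Cauchy_def by metis
    obtain M' where M': "\<And>m n. m \<ge> M' \<Longrightarrow> n \<ge> M' \<Longrightarrow> seminorm (difference (Y m) (Y n)) < e / 2"
      using Y e unfolding approximates_def seminorm_Cauchy_def by metis
    have "seminorm (difference (X m @ Y m) (X n @ Y n)) < e"
      if "m \<ge> max M M'" "n \<ge> max M M'" for m n
    proof -
      have "seminorm (difference (X m @ Y m) (X n @ Y n)) =
          seminorm (difference (X m) (X n) @ difference (Y m) (Y n))"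
        by (rule seminorm_cong) auto
      also have "\<dots> \<le> seminorm (difference (X m) (X n)) + seminorm (difference (Y m) (Y n))"
        by (rule seminorm_append_le)
      finally show ?thesis using M[of m n] M'[of m n] that by simp
    qed
    then show "\<exists>M. \<forall>m\<ge>M. \<forall>n\<ge>M. seminorm (difference (X m @ Y m) (X n @ Y n)) < e" by blast
  qed
  show "\<forall>s. (\<lambda>n. combination (X n @ Y n) s) \<longlonglongrightarrow> f s + h s"
    using X Y by (auto simp: approximates_def intro: tendsto_add)
qed

lemma approximates_right_mult:
  assumes X: "approximates X f"
  shows "approximates (\<lambda>n. right_mult (X n) a) (\<lambda>s. f s * a)"
  unfolding approximates_def
proof
  show "seminorm_Cauchy (\<lambda>n. right_mult (X n) a)"
  proof (rule seminorm_Cauchy_if_dominated)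
    show "seminorm_Cauchy X" using X by (simp add: approximates_def)
    fix m n
    have "seminorm (difference (right_mult (X m) a) (right_mult (X n) a)) =
        seminorm (right_mult (difference (X m) (X n)) a)"
      by (rule seminorm_cong) (auto simp: left_diff_distrib)
    then show "seminorm (difference (right_mult (X m) a) (right_mult (X n) a))
        \<le> norm a * seminorm (difference (X m) (X n))"
      using seminorm_right_mult_le[of "difference (X m) (X n)" a] by (simp add: mult.commute)
  qed simp
  show "\<forall>s. (\<lambda>n. combination (right_mult (X n) a) s) \<longlonglongrightarrow> f s * a"
    using X by (auto simp: approximates_def intro: tendsto_mult)
qed

lemma approximates_difference:
  assumes "approximates X f" "approximates Y h"
  shows "approximates (\<lambda>n. difference (X n) (Y n)) (\<lambda>s. f s - h s)"
  using approximates_append[OF assms(1) approximates_right_mult[OF assms(2), of "- 1"]]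
  by (simp add: difference_def)

lemma approximates_const: "approximates (\<lambda>_. xs) (combination xs)"
  by (simp add: approximates_def seminorm_Cauchy_def)

lemma combination_in_kernel_space: "combination xs \<in> kernel_space"
  using approximates_const unfolding kernel_space_def by blast

lemma seminorm_Cauchy_bounded:
  assumes "seminorm_Cauchy X"
  shows "\<exists>B>0. \<forall>n. seminorm (X n) \<le> B"
proof -
  obtain M where M: "\<And>m n. m \<ge> M \<Longrightarrow> n \<ge> M \<Longrightarrow> seminorm (difference (X m) (X n)) < 1"
    using assms unfolding seminorm_Cauchy_def by (metis zero_less_one)
  define B where "B = Max (seminorm ` X ` {..M}) + 1"
  have le: "seminorm (X n) \<le> B - 1" if "n \<le> M" for n
    using that by (auto simp: B_def intro!: Max_ge)
  have "seminorm (X n) \<le> B" for n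
  proof (cases "n \<le> M")
    case False
    then show ?thesis
      using seminorm_le_difference[of "X n" "X M"] M[of n M] le[of M] by simp
  qed (use le in force)
  moreover have "B > 0" using le[of M] seminorm_nonneg[of "X M"] by linarith
  ultimately show ?thesis by blast
qed

text \<open>
  The completion embeds into the functions: a Cauchy sequence of combinations that tends to \<open>0\<close>
  pointwise tends to \<open>0\<close> in norm, since \<open>\<langle>X\<^sub>n, X\<^sub>n\<rangle>\<close> is close to \<open>\<langle>X\<^sub>m, X\<^sub>n\<rangle>\<close> for a fixed large \<open>m\<close>,
  and the latter is a finite combination of values of the \<open>n\<close>-th function.
\<close>

lemma seminorm_tendsto_zero_if_pointwise:
  assumes X: "approximates X (\<lambda>_. 0)"
  shows "(\<lambda>n. seminorm (X n)) \<longlonglongrightarrow> 0"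
proof (rule LIMSEQ_I)
  fix e :: real assume e: "e > 0"
  have C: "seminorm_Cauchy X" using X by (simp add: approximates_def)
  obtain B where B: "B > 0" "\<And>n. seminorm (X n) \<le> B"
    using seminorm_Cauchy_bounded[OF C] by blast
  define d where "d = e\<^sup>2 / (2 * B)"
  have d: "d > 0" "B * d = e\<^sup>2 / 2" using e B by (simp_all add: d_def)
  obtain M where M: "\<And>m n. m \<ge> M \<Longrightarrow> n \<ge> M \<Longrightarrow> seminorm (difference (X m) (X n)) < d"
    using C d(1) unfolding seminorm_Cauchy_def by metis
  have "(\<lambda>n. gram (X M) (X n)) \<longlonglongrightarrow> pairing (X M) (\<lambda>_. 0)"
    unfolding gram_def using X by (intro pairing_tendsto) (simp add: approximates_def)
  then obtain M' where M': "\<And>n. n \<ge> M' \<Longrightarrow> norm (gram (X M) (X n)) < e\<^sup>2 / 2"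
    using LIMSEQ_D[of _ 0 "e\<^sup>2 / 2"] e by (metis diff_zero half_gt_zero pairing_zero zero_less_power)
  show "\<exists>no. \<forall>n\<ge>no. norm (seminorm (X n) - 0) < e"
  proof (intro exI allI impI)
    fix n assume n: "n \<ge> max M M'"
    have "gram (X n) (X n) = gram (difference (X n) (X M)) (X n) + gram (X M) (X n)"
      by (simp add: gram_difference_left)
    then have "(seminorm (X n))\<^sup>2 \<le> seminorm (difference (X n) (X M)) * seminorm (X n)
        + norm (gram (X M) (X n))"
      unfolding seminorm_square
      using norm_triangle_ineq[of "gram (difference (X n) (X M)) (X n)" "gram (X M) (X n)"]
        norm_gram_le[of "difference (X n) (X M)" "X n"] by simp
    also have "seminorm (difference (X n) (X M)) * seminorm (X n) \<le> d * B"
      using M[of n M] n B(2)[of n] d by (intro mult_mono) auto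
    also have "d * B = e\<^sup>2 / 2" using d(2) by (simp add: mult.commute)
    also have "norm (gram (X M) (X n)) < e\<^sup>2 / 2" using M'[of n] n by simp
    finally have "(seminorm (X n))\<^sup>2 < e\<^sup>2" by simp
    then show "norm (seminorm (X n) - 0) < e"
      using e by (simp add: power2_less_imp_less)
  qed
qed

lemma gram_diff_tendsto_zero:
  assumes X: "approximates X f" and X': "approximates X' f"
    and Y: "approximates Y h" and Y': "approximates Y' h"
  shows "(\<lambda>n. gram (X n) (Y n) - gram (X' n) (Y' n)) \<longlonglongrightarrow> 0"
proof -
  obtain B where B: "B > 0" "\<And>n. seminorm (Y n) \<le> B"
    using seminorm_Cauchy_bounded Y unfolding approximates_def by blast
  obtain B' where B': "B' > 0" "\<And>n. seminorm (X' n) \<le> B'"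
    using seminorm_Cauchy_bounded X' unfolding approximates_def by blast
  let ?dX = "\<lambda>n. seminorm (difference (X n) (X' n))"
  let ?dY = "\<lambda>n. seminorm (difference (Y n) (Y' n))"
  have "?dX \<longlonglongrightarrow> 0" "?dY \<longlonglongrightarrow> 0"
    using approximates_difference[OF X X'] approximates_difference[OF Y Y']
    by (simp_all add: seminorm_tendsto_zero_if_pointwise)
  then have lim: "(\<lambda>n. ?dX n * B + B' * ?dY n) \<longlonglongrightarrow> 0"
    by (auto intro!: tendsto_eq_intros)
  have "norm (gram (X n) (Y n) - gram (X' n) (Y' n)) \<le> ?dX n * B + B' * ?dY n" for n
  proof -
    have "?dX n * seminorm (Y n) + seminorm (X' n) * ?dY n \<le> ?dX n * B + B' * ?dY n"
      by (intro add_mono mult_left_mono mult_right_mono B B') auto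
    then show ?thesis using norm_gram_diff_le order_trans by blast
  qed
  then show ?thesis by (intro Lim_null_comparison[OF always_eventually lim] allI)
qed

lemma gram_convergent:
  assumes X: "seminorm_Cauchy X" and Y: "seminorm_Cauchy Y"
  shows "convergent (\<lambda>n. gram (X n) (Y n))"
proof (rule Cauchy_convergent, rule CauchyI)
  fix e :: real assume e: "e > 0"
  obtain B where B: "B > 0" "\<And>n. seminorm (Y n) \<le> B" using seminorm_Cauchy_bounded[OF Y] by blast
  obtain B' where B': "B' > 0" "\<And>n. seminorm (X n) \<le> B'" using seminorm_Cauchy_bounded[OF X] by blast
  have pos: "e / (2 * B) > 0" "e / (2 * B') > 0" using e B B' by simp_all
  obtain M where M: "\<And>m n. m \<ge> M \<Longrightarrow> n \<ge> M \<Longrightarrow> seminorm (difference (X m) (X n)) < e / (2 * B)"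
    using X pos(1) unfolding seminorm_Cauchy_def by metis
  obtain M' where M': "\<And>m n. m \<ge> M' \<Longrightarrow> n \<ge> M' \<Longrightarrow> seminorm (difference (Y m) (Y n)) < e / (2 * B')"
    using Y pos(2) unfolding seminorm_Cauchy_def by metis
  show "\<exists>M. \<forall>m\<ge>M. \<forall>n\<ge>M. norm (gram (X m) (Y m) - gram (X n) (Y n)) < e"
  proof (intro exI allI impI)
    fix m n assume mn: "m \<ge> max M M'" "n \<ge> max M M'"
    have "seminorm (difference (X m) (X n)) * seminorm (Y m) \<le> seminorm (difference (X m) (X n)) * B"
      by (intro mult_left_mono B) simp
    also have "\<dots> < e / (2 * B) * B" using M[of m n] mn B by (intro mult_strict_right_mono) auto
    finally have 1: "seminorm (difference (X m) (X n)) * seminorm (Y m) < e / 2" using B by simp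
    have "seminorm (X n) * seminorm (difference (Y m) (Y n)) \<le> B' * seminorm (difference (Y m) (Y n))"
      by (intro mult_right_mono B') simp
    also have "\<dots> < B' * (e / (2 * B'))" using M'[of m n] mn B' by (intro mult_strict_left_mono) auto
    finally have 2: "seminorm (X n) * seminorm (difference (Y m) (Y n)) < e / 2" using B' by simp
    show "norm (gram (X m) (Y m) - gram (X n) (Y n)) < e"
      using norm_gram_diff_le[of "X m" "Y m" "X n" "Y n"] 1 2 by linarith
  qed
qed

lemma kernel_inner_tendsto:
  assumes X: "approximates X f" and Y: "approximates Y h"
  shows "(\<lambda>n. gram (X n) (Y n)) \<longlonglongrightarrow> kernel_inner f h"
proof -
  define X' where "X' = (SOME X. approximates X f)"
  define Y' where "Y' = (SOME Y. approximates Y h)"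
  have X': "approximates X' f" unfolding X'_def by (rule someI[of "\<lambda>X. approximates X f", OF X])
  have Y': "approximates Y' h" unfolding Y'_def by (rule someI[of "\<lambda>Y. approximates Y h", OF Y])
  have "convergent (\<lambda>n. gram (X' n) (Y' n))"
    using X' Y' by (intro gram_convergent) (simp_all add: approximates_def)
  then have "(\<lambda>n. gram (X' n) (Y' n)) \<longlonglongrightarrow> kernel_inner f h"
    by (simp add: convergent_LIMSEQ_iff kernel_inner_def X'_def Y'_def)
  from tendsto_add[OF this gram_diff_tendsto_zero[OF X X' Y Y']] show ?thesis by simp
qed

lemma kernel_inner_eqI:
  assumes "approximates X f" "approximates Y h" "(\<lambda>n. gram (X n) (Y n)) \<longlonglongrightarrow> l"
  shows "kernel_inner f h = l"
  using kernel_inner_tendsto[OF assms(1,2)] assms(3) by (rule LIMSEQ_unique)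

lemma kernel_inner_combination: "kernel_inner (combination xs) (combination ys) = gram xs ys"
  by (rule kernel_inner_eqI[OF approximates_const approximates_const]) simp

lemma fnorm_tendsto: "approximates X f \<Longrightarrow> (\<lambda>n. seminorm (X n)) \<longlonglongrightarrow> fnorm f"
  unfolding seminorm_def fnorm_def by (intro tendsto_intros kernel_inner_tendsto)

lemma fnorm_nonneg [simp]: "fnorm f \<ge> 0"
  by (simp add: fnorm_def)

lemma fnorm_diff_tendsto:
  assumes "approximates X f" "approximates Y h"
  shows "(\<lambda>n. seminorm (difference (X n) (Y n))) \<longlonglongrightarrow> fnorm (\<lambda>s. f s - h s)"
  by (rule fnorm_tendsto[OF approximates_difference[OF assms]])

lemma fnorm_diff_combination:
  "fnorm (\<lambda>s. combination xs s - combination ys s) = seminorm (difference xs ys)"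
  using fnorm_diff_tendsto[OF approximates_const approximates_const, of xs ys]
  by (simp add: LIMSEQ_const_iff)

lemma fnorm_diff_commute:
  assumes "f \<in> kernel_space" "h \<in> kernel_space"
  shows "fnorm (\<lambda>s. f s - h s) = fnorm (\<lambda>s. h s - f s)"
proof -
  obtain X Y where XY: "approximates X f" "approximates Y h"
    using assms by (auto simp: kernel_space_def)
  from fnorm_diff_tendsto[OF XY] fnorm_diff_tendsto[OF XY(2,1)] show ?thesis
    by (metis (no_types, lifting) LIMSEQ_unique ext seminorm_difference_commute)
qed

lemma fnorm_diff_triangle:
  assumes "f \<in> kernel_space" "h \<in> kernel_space" "k \<in> kernel_space"
  shows "fnorm (\<lambda>s. f s - k s) \<le> fnorm (\<lambda>s. f s - h s) + fnorm (\<lambda>s. h s - k s)"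
proof -
  obtain X Y Z where XYZ: "approximates X f" "approximates Y h" "approximates Z k"
    using assms by (auto simp: kernel_space_def)
  have "(\<lambda>n. seminorm (difference (X n) (Y n)) + seminorm (difference (Y n) (Z n)))
      \<longlonglongrightarrow> fnorm (\<lambda>s. f s - h s) + fnorm (\<lambda>s. h s - k s)"
    by (intro tendsto_add fnorm_diff_tendsto XYZ)
  with fnorm_diff_tendsto[OF XYZ(1,3)] show ?thesis
    by (rule LIMSEQ_le) (auto intro: seminorm_difference_triangle)
qed

lemma approximates_fnorm:
  assumes X: "approximates X f" and e: "e > 0"
  shows "\<exists>M. \<forall>m\<ge>M. fnorm (\<lambda>s. f s - combination (X m) s) < e"
proof -
  have "e / 2 > 0" using e by simp
  then obtain M where M: "\<And>m n. m \<ge> M \<Longrightarrow> n \<ge> M \<Longrightarrow> seminorm (difference (X m) (X n)) < e / 2"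
    using X unfolding approximates_def seminorm_Cauchy_def by metis
  have "fnorm (\<lambda>s. f s - combination (X m) s) \<le> e / 2" if m: "m \<ge> M" for m
  proof (rule LIMSEQ_le_const2)
    show "(\<lambda>n. seminorm (difference (X n) (X m))) \<longlonglongrightarrow> fnorm (\<lambda>s. f s - combination (X m) s)"
      by (rule fnorm_diff_tendsto[OF X approximates_const])
    show "\<exists>N. \<forall>n\<ge>N. seminorm (difference (X n) (X m)) \<le> e / 2"
      using M[OF _ m] by (intro exI[of _ M] allI impI less_imp_le)
  qed
  then show ?thesis using e by (intro exI[of _ M]) force
qed

lemma combination_dense:
  assumes "f \<in> kernel_space" "e > 0"
  shows "\<exists>xs. fnorm (\<lambda>s. f s - combination xs s) < e"
  using assms approximates_fnorm unfolding kernel_space_def by blast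

lemma approximates_if_Cauchy:
  assumes X: "seminorm_Cauchy X"
  shows "\<exists>f. approximates X f"
proof -
  have "convergent (\<lambda>n. combination (X n) s)" for s
    unfolding combination_eq_gram
    by (rule gram_convergent[OF _ X]) (simp add: seminorm_Cauchy_def)
  then show ?thesis
    using X unfolding approximates_def convergent_def by metis
qed

text \<open>
  Replace the \<open>n\<close>-th function by a combination at distance less than \<open>1 / (n + 1)\<close>.  These
  combinations form a Cauchy sequence, and its pointwise limit is also the limit in norm.
\<close>

lemma kernel_space_complete:
  fixes F :: "nat \<Rightarrow> 's \<Rightarrow> 'a"
  assumes F: "\<And>n. F n \<in> kernel_space"
    and C: "\<And>e. e > 0 \<Longrightarrow> \<exists>N. \<forall>m\<ge>N. \<forall>n\<ge>N. fnorm (\<lambda>s. F m s - F n s) < e"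
  shows "\<exists>f\<in>kernel_space. (\<lambda>n. fnorm (\<lambda>s. F n s - f s)) \<longlonglongrightarrow> 0"
proof -
  have "\<exists>xs. fnorm (\<lambda>s. F n s - combination xs s) < inverse (real (Suc n))" for n
    by (rule combination_dense[OF F]) simp
  then obtain Z where Z: "\<And>n. fnorm (\<lambda>s. F n s - combination (Z n) s) < inverse (real (Suc n))"
    by metis
  have small: "\<exists>N. \<forall>n\<ge>N. fnorm (\<lambda>s. F n s - combination (Z n) s) < e" if e: "e > 0" for e :: real
  proof -
    obtain N where "inverse (real (Suc N)) < e" using reals_Archimedean[OF e] by blast
    moreover have "inverse (real (Suc n)) \<le> inverse (real (Suc N))" if "n \<ge> N" for n
      using that by simp
    ultimately show ?thesis using Z by (meson less_le_trans less_trans)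
  qed
  have "seminorm_Cauchy Z"
    unfolding seminorm_Cauchy_def
  proof (intro allI impI)
    fix e :: real assume e: "e > 0"
    obtain N where N: "\<And>m n. m \<ge> N \<Longrightarrow> n \<ge> N \<Longrightarrow> fnorm (\<lambda>s. F m s - F n s) < e / 3"
      using C[of "e / 3"] e by auto
    obtain N' where N': "\<And>n. n \<ge> N' \<Longrightarrow> fnorm (\<lambda>s. F n s - combination (Z n) s) < e / 3"
      using small[of "e / 3"] e by auto
    have "seminorm (difference (Z m) (Z n)) < e" if mn: "m \<ge> max N N'" "n \<ge> max N N'" for m n
    proof -
      note mem = F[of m] F[of n] combination_in_kernel_space[of "Z m"] combination_in_kernel_space[of "Z n"]
      have "seminorm (difference (Z m) (Z n)) \<le>
          fnorm (\<lambda>s. combination (Z m) s - F m s) + fnorm (\<lambda>s. F m s - combination (Z n) s)"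
        unfolding fnorm_diff_combination[symmetric] by (intro fnorm_diff_triangle mem)
      also have "fnorm (\<lambda>s. F m s - combination (Z n) s) \<le>
          fnorm (\<lambda>s. F m s - F n s) + fnorm (\<lambda>s. F n s - combination (Z n) s)"
        by (intro fnorm_diff_triangle mem)
      also have "fnorm (\<lambda>s. combination (Z m) s - F m s) = fnorm (\<lambda>s. F m s - combination (Z m) s)"
        by (intro fnorm_diff_commute mem)
      finally show ?thesis using N[of m n] N'[of m] N'[of n] mn by simp
    qed
    then show "\<exists>M. \<forall>m\<ge>M. \<forall>n\<ge>M. seminorm (difference (Z m) (Z n)) < e" by blast
  qed
  then obtain f where f: "approximates Z f" using approximates_if_Cauchy by blast
  have mem: "f \<in> kernel_space" using f by (auto simp: kernel_space_def)
  have "(\<lambda>n. fnorm (\<lambda>s. F n s - f s)) \<longlonglongrightarrow> 0"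
  proof (rule LIMSEQ_I)
    fix e :: real assume e: "e > 0"
    obtain N where N: "\<And>n. n \<ge> N \<Longrightarrow> fnorm (\<lambda>s. F n s - combination (Z n) s) < e / 2"
      using small[of "e / 2"] e by auto
    obtain N' where N': "\<And>n. n \<ge> N' \<Longrightarrow> fnorm (\<lambda>s. f s - combination (Z n) s) < e / 2"
      using approximates_fnorm[OF f, of "e / 2"] e by auto
    show "\<exists>no. \<forall>n\<ge>no. norm (fnorm (\<lambda>s. F n s - f s) - 0) < e"
    proof (intro exI allI impI)
      fix n assume n: "n \<ge> max N N'"
      have "fnorm (\<lambda>s. F n s - f s) \<le>
          fnorm (\<lambda>s. F n s - combination (Z n) s) + fnorm (\<lambda>s. combination (Z n) s - f s)"
        by (intro fnorm_diff_triangle F combination_in_kernel_space mem)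
      also have "fnorm (\<lambda>s. combination (Z n) s - f s) = fnorm (\<lambda>s. f s - combination (Z n) s)"
        by (intro fnorm_diff_commute combination_in_kernel_space mem)
      finally show "norm (fnorm (\<lambda>s. F n s - f s) - 0) < e" using N[of n] N'[of n] n by simp
    qed
  qed
  then show ?thesis using mem by blast
qed

subsection \<open>The module structure\<close>

definition kernel_module :: "('a, 's \<Rightarrow> 'a) hilbert_module" where
  "kernel_module = \<lparr>carrier = kernel_space, mult = (\<lambda>f h. f), one = (\<lambda>_. 0), zero = (\<lambda>_. 0),
     add = (\<lambda>f h s. f s + h s), cscale = (\<lambda>z f s. z *\<^sub>C f s), act = (\<lambda>f a s. f s * a),
     ip = kernel_inner\<rparr>"

lemma kernel_module_simps [simp]:
  "carrier kernel_module = kernel_space"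
  "zero kernel_module = (\<lambda>_. 0)"
  "add kernel_module = (\<lambda>f h s. f s + h s)"
  "cscale kernel_module = (\<lambda>z f s. z *\<^sub>C f s)"
  "act kernel_module = (\<lambda>f a s. f s * a)"
  "ip kernel_module = kernel_inner"
  by (simp_all add: kernel_module_def)

lemma mnorm_kernel_module [simp]: "mnorm kernel_module f = fnorm f"
  by (simp add: mnorm_def fnorm_def)

lemma kernel_space_zero: "(\<lambda>_. 0) \<in> kernel_space"
  using combination_in_kernel_space[of "[]"] by (simp add: combination_def[abs_def])

lemma kernel_space_add: "f \<in> kernel_space \<Longrightarrow> h \<in> kernel_space \<Longrightarrow> (\<lambda>s. f s + h s) \<in> kernel_space"
  unfolding kernel_space_def using approximates_append by blast

lemma kernel_space_mult: "f \<in> kernel_space \<Longrightarrow> (\<lambda>s. f s * a) \<in> kernel_space"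
  unfolding kernel_space_def using approximates_right_mult by blast

lemma kernel_space_scaleC: "f \<in> kernel_space \<Longrightarrow> (\<lambda>s. z *\<^sub>C f s) \<in> kernel_space"
  using kernel_space_mult[of f "z *\<^sub>C 1"] by (simp add: mult_scaleC_right)

lemma kernel_space_minus: "f \<in> kernel_space \<Longrightarrow> (\<lambda>s. - f s) \<in> kernel_space"
  using kernel_space_mult[of f "- 1"] by simp

lemma abelian_group_kernel_module: "abelian_group kernel_module"
proof (rule abelian_groupI)
  fix f assume "f \<in> carrier kernel_module"
  then show "\<exists>h\<in>carrier kernel_module. h \<oplus>\<^bsub>kernel_module\<^esub> f = \<zero>\<^bsub>kernel_module\<^esub>"
    by (intro bexI[of _ "\<lambda>s. - f s"]) (auto simp: kernel_space_minus)
qed (auto simp: kernel_space_add kernel_space_zero add_ac)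

lemma minus_kernel_module:
  assumes "f \<in> kernel_space" "h \<in> kernel_space"
  shows "f \<ominus>\<^bsub>kernel_module\<^esub> h = (\<lambda>s. f s - h s)"
proof -
  interpret abelian_group kernel_module by (rule abelian_group_kernel_module)
  have "\<ominus>\<^bsub>kernel_module\<^esub> h = (\<lambda>s. - h s)"
    using minus_equality[of "\<lambda>s. - h s" h] assms by (simp add: kernel_space_minus)
  then show ?thesis by (simp add: a_minus_def)
qed

lemma kernel_inner_add_right:
  assumes "f \<in> kernel_space" "h \<in> kernel_space" "k \<in> kernel_space"
  shows "kernel_inner f (\<lambda>s. h s + k s) = kernel_inner f h + kernel_inner f k"
proof -
  obtain X Y Z where XYZ: "approximates X f" "approximates Y h" "approximates Z k"
    using assms by (auto simp: kernel_space_def)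
  show ?thesis
    by (rule kernel_inner_eqI[OF XYZ(1) approximates_append[OF XYZ(2,3)]])
      (simp add: gram_append_right tendsto_add kernel_inner_tendsto XYZ)
qed

lemma kernel_inner_mult_right:
  assumes "f \<in> kernel_space" "h \<in> kernel_space"
  shows "kernel_inner f (\<lambda>s. h s * a) = kernel_inner f h * a"
proof -
  obtain X Y where XY: "approximates X f" "approximates Y h"
    using assms by (auto simp: kernel_space_def)
  show ?thesis
    by (rule kernel_inner_eqI[OF XY(1) approximates_right_mult[OF XY(2)]])
      (simp add: gram_right_mult_right tendsto_mult kernel_inner_tendsto XY)
qed

lemma kernel_inner_scaleC_right:
  assumes "f \<in> kernel_space" "h \<in> kernel_space"
  shows "kernel_inner f (\<lambda>s. z *\<^sub>C h s) = z *\<^sub>C kernel_inner f h"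
  using kernel_inner_mult_right[OF assms, of "z *\<^sub>C 1"] by (simp add: mult_scaleC_right)

lemma star_kernel_inner:
  assumes "f \<in> kernel_space" "h \<in> kernel_space"
  shows "star (kernel_inner f h) = kernel_inner h f"
proof -
  obtain X Y where XY: "approximates X f" "approximates Y h"
    using assms by (auto simp: kernel_space_def)
  show ?thesis
    using tendsto_star[OF kernel_inner_tendsto[OF XY]]
    by (intro kernel_inner_eqI[OF XY(2,1), symmetric]) (simp add: star_gram)
qed

lemma kernel_inner_positive: "f \<in> kernel_space \<Longrightarrow> kernel_inner f f \<in> positive_cone"
  by (auto simp: kernel_space_def intro: positive_limit[OF gram_positive kernel_inner_tendsto])

text \<open>
  Evaluation at \<open>s\<close> is bounded by the norm, as it is the inner product with the kernel function at \<open>s\<close>.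
\<close>

lemma kernel_inner_definite:
  assumes "f \<in> kernel_space" "kernel_inner f f = 0"
  shows "f = (\<lambda>_. 0)"
proof
  fix s
  obtain X where X: "approximates X f" using assms(1) by (auto simp: kernel_space_def)
  have "(\<lambda>n. seminorm (X n)) \<longlonglongrightarrow> 0"
    using fnorm_tendsto[OF X] assms(2) by (simp add: fnorm_def)
  from tendsto_mult_right_zero[OF this]
  have lim: "(\<lambda>n. seminorm [(s, 1)] * seminorm (X n)) \<longlonglongrightarrow> 0" .
  have "(\<lambda>n. combination (X n) s) \<longlonglongrightarrow> 0"
    by (rule Lim_null_comparison[OF always_eventually lim]) (simp add: norm_combination_le)
  moreover have "(\<lambda>n. combination (X n) s) \<longlonglongrightarrow> f s" using X by (simp add: approximates_def)
  ultimately show "f s = 0" by (rule LIMSEQ_unique[symmetric])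
qed

lemma hilbert_module_kernel_module: "hilbert_module kernel_module"
proof (intro hilbert_module.intro hilbert_module_axioms.intro abelian_group_kernel_module)
  fix F :: "nat \<Rightarrow> 's \<Rightarrow> 'a"
  assume F: "\<And>n. F n \<in> carrier kernel_module"
    and C: "\<And>e. e > 0 \<Longrightarrow>
      \<exists>N. \<forall>m\<ge>N. \<forall>n\<ge>N. mnorm kernel_module (F m \<ominus>\<^bsub>kernel_module\<^esub> F n) < e"
  show "\<exists>f\<in>carrier kernel_module. (\<lambda>n. mnorm kernel_module (F n \<ominus>\<^bsub>kernel_module\<^esub> f)) \<longlonglongrightarrow> 0"
    using kernel_space_complete[of F] F C by (auto simp: minus_kernel_module)
qed (auto simp: kernel_space_scaleC kernel_space_mult scaleC_add_right scaleC_add_left scaleC_scaleC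
    distrib_right distrib_left mult.assoc mult_scaleC_left mult_scaleC_right kernel_inner_add_right
    kernel_inner_scaleC_right kernel_inner_mult_right star_kernel_inner kernel_inner_positive kernel_inner_definite)

lemma combination_in_generated_submodule:
  "combination xs \<in> generated_submodule kernel_module (range (\<lambda>t. combination [(t, 1)]))"
  unfolding generated_submodule_def hull_def
proof (rule InterI)
  fix S assume "S \<in> {S. hilbert_submodule kernel_module S \<and> range (\<lambda>t. combination [(t, 1)]) \<subseteq> S}"
  then have S: "hilbert_submodule kernel_module S" "\<And>t. combination [(t, 1)] \<in> S" by auto
  show "combination xs \<in> S"
  proof (induction xs)
    case Nil
    then show ?case using S(1) by (simp add: hilbert_submodule_def combination_def[abs_def])
  next
    case (Cons x xs)
    obtain t b where x: "x = (t, b)" by (cases x)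
    have "(\<lambda>s. combination [(t, 1)] s * b) \<in> S"
      using S(1) S(2)[of t] unfolding hilbert_submodule_def kernel_module_simps by blast
    then have "(\<lambda>s. combination [(t, 1)] s * b + combination xs s) \<in> S"
      using S(1) Cons by (simp add: hilbert_submodule_def)
    moreover have "combination (x # xs) = (\<lambda>s. combination [(t, 1)] s * b + combination xs s)"
      by (auto simp: x)
    ultimately show ?case by simp
  qed
qed

lemma generated_submodule_dense:
  "dense_in_module kernel_module
    (generated_submodule kernel_module (range (\<lambda>t. combination [(t, 1)])))"
  unfolding dense_in_module_def
proof (intro ballI allI impI)
  fix f and e :: real assume "f \<in> carrier kernel_module" "e > 0"
  then obtain xs where "fnorm (\<lambda>s. f s - combination xs s) < e"
    using combination_dense by auto
  then show "\<exists>h\<in>generated_submodule kernel_module (range (\<lambda>t. combination [(t, 1)])).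
      mnorm kernel_module (f \<ominus>\<^bsub>kernel_module\<^esub> h) < e"
    using combination_in_generated_submodule \<open>f \<in> carrier kernel_module\<close>
    by (intro bexI[of _ "combination xs"]) (simp_all add: minus_kernel_module combination_in_kernel_space)
qed

end

section \<open>Maps induced on the module\<close>

context positive_kernel
begin

text \<open>
  A map of formal sums that twists the Gram form by an automorphism extends to the completion
  when it is induced by a pointwise continuous map \<open>v\<close> of functions, because automorphisms are
  contractive.
\<close>

context
  fixes \<phi> :: "'a \<Rightarrow> 'a" and T :: "('s \<times> 'a) list \<Rightarrow> ('s \<times> 'a) list"
    and v :: "('s \<Rightarrow> 'a) \<Rightarrow> 's \<Rightarrow> 'a"
  assumes aut: "cstar_automorphism \<phi>"
    and combination_T: "\<And>xs. combination (T xs) = v (combination xs)"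
    and gram_T: "\<And>xs ys. gram (T xs) (T ys) = \<phi> (gram xs ys)"
    and v_diff: "\<And>f h. v (\<lambda>s. f s - h s) = (\<lambda>s. v f s - v h s)"
    and v_tendsto: "\<And>F f s. (\<And>t. (\<lambda>n. F n t) \<longlonglongrightarrow> f t) \<Longrightarrow> (\<lambda>n. v (F n) s) \<longlonglongrightarrow> v f s"
begin

lemma approximates_map:
  assumes X: "approximates X f"
  shows "approximates (\<lambda>n. T (X n)) (v f)"
  unfolding approximates_def
proof
  show "seminorm_Cauchy (\<lambda>n. T (X n))"
  proof (rule seminorm_Cauchy_if_dominated)
    show "seminorm_Cauchy X" using X by (simp add: approximates_def)
    fix m n
    have "combination (difference (X m) (X n)) = (\<lambda>s. combination (X m) s - combination (X n) s)"
      by auto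
    then have "combination (T (difference (X m) (X n))) = combination (difference (T (X m)) (T (X n)))"
      by (auto simp: combination_T v_diff)
    then have "seminorm (difference (T (X m)) (T (X n))) = seminorm (T (difference (X m) (X n)))"
      by (rule seminorm_cong[symmetric])
    also have "\<dots> \<le> seminorm (difference (X m) (X n))"
      unfolding seminorm_def gram_T by (simp add: cstar_automorphism_norm_le[OF aut])
    finally show "seminorm (difference (T (X m)) (T (X n))) \<le> 1 * seminorm (difference (X m) (X n))"
      by simp
  qed simp
  show "\<forall>s. (\<lambda>n. combination (T (X n)) s) \<longlonglongrightarrow> v f s"
    using X by (auto simp: combination_T approximates_def intro: v_tendsto)
qed

lemma kernel_space_map: "f \<in> kernel_space \<Longrightarrow> v f \<in> kernel_space"
  unfolding kernel_space_def using approximates_map by blast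

lemma kernel_inner_map:
  assumes "f \<in> kernel_space" "h \<in> kernel_space"
  shows "kernel_inner (v f) (v h) = \<phi> (kernel_inner f h)"
proof -
  obtain X Y where XY: "approximates X f" "approximates Y h"
    using assms by (auto simp: kernel_space_def)
  show ?thesis
    using cstar_automorphism_tendsto[OF aut kernel_inner_tendsto[OF XY]]
    by (intro kernel_inner_eqI[OF approximates_map[OF XY(1)] approximates_map[OF XY(2)]])
      (simp add: gram_T)
qed

end

end

section \<open>The cocycle of a negative definite function\<close>

locale negative_definite_function =
  fixes \<alpha> :: "'g::group_add \<Rightarrow> 'a::unital_cstar_algebra \<Rightarrow> 'a"
    and \<psi> :: "'g \<Rightarrow> 'a"
  assumes action: "cstar_action \<alpha>"
    and positive: "\<And>g. \<psi> g \<in> positive_cone"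
    and neg_def: "negative_definite \<alpha> \<psi>"
    and norm: "normalized \<psi>"
begin

lemma automorphism: "cstar_automorphism (\<alpha> g)"
  using action by (simp add: cstar_action_def)

lemmas action_simps =
  cstar_automorphism_add[OF automorphism] cstar_automorphism_diff[OF automorphism]
  cstar_automorphism_zero[OF automorphism] cstar_automorphism_minus[OF automorphism]
  cstar_automorphism_scaleR[OF automorphism] cstar_automorphism_scaleC[OF automorphism]
  cstar_automorphism_mult[OF automorphism] cstar_automorphism_star[OF automorphism]

lemma action_add: "\<alpha> (g + h) a = \<alpha> g (\<alpha> h a)"
  using action by (simp add: cstar_action_def)

lemma action_zero [simp]: "\<alpha> 0 a = a"
proof -
  obtain b where "\<alpha> 0 b = a" using cstar_automorphism_preimage[OF automorphism] by blast
  then show ?thesis using action_add[of 0 0 b] by simp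
qed

lemma star_psi [simp]: "star (\<psi> g) = \<psi> g"
  using positive_self_adjoint[OF positive[of g]] by (simp add: self_adjoint_def)

lemma psi_zero [simp]: "\<psi> 0 = 0"
  using norm by (simp add: normalized_def)

lemma action_psi_minus [simp]: "\<alpha> g (\<psi> (- g)) = \<psi> g"
  using neg_def by (simp add: negative_definite_def)

text \<open>
  As \<open>\<psi>\<close> is self-adjoint, its hermitian symmetry at \<open>- g + h\<close> reads
  \<open>\<alpha>\<^bsub>- g + h\<^esub>(\<psi>(- h + g)) = \<psi>(- g + h)\<close>; apply \<open>\<alpha>\<^sub>g\<close>.
\<close>

lemma action_psi_symmetric: "\<alpha> h (\<psi> (- h + g)) = \<alpha> g (\<psi> (- g + h))"
proof -
  have "\<alpha> (- g + h) (\<psi> (- (- g + h))) = \<psi> (- g + h)" by (rule action_psi_minus)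
  then have "\<alpha> g (\<alpha> (- g + h) (\<psi> (- h + g))) = \<alpha> g (\<psi> (- g + h))" by (simp add: minus_add)
  then show ?thesis by (simp flip: action_add add: add.assoc[symmetric])
qed

text \<open>
  Polarization of \<open>\<alpha>\<^sub>g(\<psi>(- g + h)) = \<langle>c(g) - c(h), c(g) - c(h)\<rangle>\<close>, for inner products
  \<open>\<langle>c(g), c(h)\<rangle>\<close> that are self-adjoint.
\<close>

definition K :: "'g \<Rightarrow> 'g \<Rightarrow> 'a" where
  "K g h = (1/2) *\<^sub>R (\<psi> g + \<psi> h - \<alpha> g (\<psi> (- g + h)))"

lemma K_self_adjoint: "star (K g h) = K g h"
  by (simp add: K_def star_scaleR star_diff star_add flip: action_simps)

lemma K_symmetric: "K g h = K h g"
  by (simp add: K_def action_psi_symmetric[of g h] add.commute)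

lemma K_zero [simp]: "K 0 g = 0" "K g 0 = 0"
  by (simp_all add: K_def)

lemma K_diagonal: "K g g = \<psi> g"
proof -
  have "\<psi> g + \<psi> g = 2 *\<^sub>R \<psi> g" by (simp add: scaleR_2)
  then show ?thesis by (simp add: K_def action_simps)
qed

text \<open>
  Adjoin the identity of the group with the coefficient \<open>- \<Sum> b\<^sub>i\<close>, which makes the coefficients
  sum to \<open>0\<close>; the terms with the identity contribute \<open>\<psi> g\<^sub>i + \<psi> g\<^sub>j\<close>.
\<close>

lemma K_positive:
  fixes n :: nat
  shows "(\<Sum>i<n. \<Sum>j<n. star (b i) * K (g i) (g j) * b j) \<in> positive_cone"
proof -
  define g' where "g' i = (if i < n then g i else 0)" for i
  define c where "c = (\<Sum>i<n. b i)"
  define b' where "b' i = (if i < n then b i else - c)" for i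
  let ?L = "\<lambda>i j. star (b' i) * \<alpha> (g' i) (\<psi> (- g' i + g' j)) * b' j"
  let ?S = "\<Sum>i<n. \<Sum>j<n. star (b i) * K (g i) (g j) * b j"
  have sum0: "(\<Sum>i<Suc n. b' i) = 0"
    by (simp add: b'_def c_def)
  have star_sum: "star (\<Sum>i<m. d i) = (\<Sum>i<m. star (d i))" for m :: nat and d :: "nat \<Rightarrow> 'a"
    by (induction m) (auto simp: star_add)
  have "star c = (\<Sum>i<n. star (b i))"
    using star_sum[of b n] by (simp add: c_def)
  have "(\<Sum>i<Suc n. \<Sum>j<Suc n. ?L i j) =
      (\<Sum>i<n. \<Sum>j<n. star (b i) * \<alpha> (g i) (\<psi> (- g i + g j)) * b j)
      - (\<Sum>i<n. star (b i) * \<psi> (g i) * c) - (\<Sum>j<n. star c * (\<psi> (g j) * b j))"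
    by (simp add: g'_def b'_def sum.distrib star_minus sum_negf sum_subtractf mult.assoc)
  also have "\<dots> = (\<Sum>i<n. \<Sum>j<n. star (b i) * \<alpha> (g i) (\<psi> (- g i + g j)) * b j)
      - (\<Sum>i<n. star (b i) * \<psi> (g i)) * (\<Sum>j<n. b j)
      - (\<Sum>i<n. star (b i)) * (\<Sum>j<n. \<psi> (g j) * b j)"
    unfolding \<open>star c = (\<Sum>i<n. star (b i))\<close>[symmetric]
    by (simp only: c_def[symmetric] sum_distrib_left sum_distrib_right)
  also have "\<dots> = (- 2) *\<^sub>R ?S"
  proof -
    have "(- 2) *\<^sub>R (star (b i) * K (g i) (g j) * b j) =
        star (b i) * \<alpha> (g i) (\<psi> (- g i + g j)) * b j - star (b i) * \<psi> (g i) * b j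
        - star (b i) * (\<psi> (g j) * b j)" for i j
      by (simp add: K_def algebra_simps)
    then have "(- 2) *\<^sub>R ?S = (\<Sum>i<n. \<Sum>j<n.
        star (b i) * \<alpha> (g i) (\<psi> (- g i + g j)) * b j - star (b i) * \<psi> (g i) * b j
        - star (b i) * (\<psi> (g j) * b j))"
      unfolding scaleR_sum_right by simp
    then show ?thesis by (simp add: sum_subtractf sum_product)
  qed
  finally have eq: "(\<Sum>i<Suc n. \<Sum>j<Suc n. ?L i j) = (- 2) *\<^sub>R ?S" .
  have "(\<Sum>i<Suc n. \<Sum>j<Suc n. ?L i j) \<le>\<^sub>A 0"
    using neg_def sum0 unfolding negative_definite_def by blast
  then have "2 *\<^sub>R ?S \<in> positive_cone" unfolding eq cstar_le_def by simp
  from positive_scaleR[OF this, of "1/2"] show ?thesis by simp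
qed

sublocale positive_kernel K
  by unfold_locales (simp_all add: K_self_adjoint K_symmetric K_positive)

text \<open>
  This is the twisted invariance of \<open>K\<close>: with \<open>translate\<close> as defined below, it says that
  \<open>translate g\<close> maps \<open>K(\<cdot>, k)\<close> to \<open>K(\<cdot>, g + k) - K(\<cdot>, g)\<close>.
\<close>

lemma K_translate: "K h (g + k) - K h g = \<alpha> g (K (- g + h) k - K (- g) k)"
proof -
  have "\<alpha> g (K (- g + h) k - K (- g) k) = (1/2) *\<^sub>R
      (\<alpha> g (\<psi> (- g + h)) - \<alpha> g (\<alpha> (- g + h) (\<psi> (- (- g + h) + k)))
       - \<alpha> g (\<psi> (- g)) + \<alpha> g (\<alpha> (- g) (\<psi> (- (- g) + k))))"
    by (simp add: K_def action_simps algebra_simps)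
  also have "\<dots> = (1/2) *\<^sub>R (\<alpha> h (\<psi> (- h + g)) - \<alpha> h (\<psi> (- h + (g + k))) - \<psi> g + \<psi> (g + k))"
    by (simp add: action_psi_symmetric[of h g] minus_add add.assoc flip: action_add)
  also have "\<dots> = K h (g + k) - K h g"
    by (simp add: K_def algebra_simps)
  finally show ?thesis by simp
qed

text \<open>
  The action has to satisfy \<open>u\<^sub>g k\<^sub>h = k\<^bsub>g + h\<^esub> - k\<^sub>g\<close>, so that \<open>h \<mapsto> k\<^sub>h\<close> becomes a cocycle.  On formal
  sums this is \<open>shift\<close>.  The corresponding map \<open>translate\<close> of functions is dictated by the
  reproducing property and equivariance:
  \<open>\<langle>k\<^sub>h, u\<^sub>g f\<rangle> = \<alpha>\<^sub>g(\<langle>u\<^bsub>- g\<^esub> k\<^sub>h, f\<rangle>) = \<alpha>\<^sub>g(\<langle>k\<^bsub>- g + h\<^esub> - k\<^bsub>- g\<^esub>, f\<rangle>)\<close>.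
\<close>

definition shift :: "'g \<Rightarrow> ('g \<times> 'a) list \<Rightarrow> ('g \<times> 'a) list" where
  "shift g xs = concat (map (\<lambda>(k, b). [(g + k, \<alpha> g b), (g, - \<alpha> g b)]) xs)"

definition translate :: "'g \<Rightarrow> ('g \<Rightarrow> 'a) \<Rightarrow> 'g \<Rightarrow> 'a" where
  "translate g f h = \<alpha> g (f (- g + h) - f (- g))"

lemma combination_shift: "combination (shift g xs) = translate g (combination xs)"
proof
  fix h
  show "combination (shift g xs) h = translate g (combination xs) h"
  proof (induction xs)
    case Nil
    then show ?case by (simp add: shift_def translate_def action_simps)
  next
    case (Cons x xs)
    obtain k b where x: "x = (k, b)" by (cases x)
    have "combination (shift g (x # xs)) h
        = (K h (g + k) - K h g) * \<alpha> g b + combination (shift g xs) h"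
      by (simp add: x shift_def algebra_simps)
    then show ?case
      by (simp add: x Cons K_translate translate_def action_simps algebra_simps)
  qed
qed

text \<open>
  The condition \<open>f 0 = 0\<close> holds throughout the module, since \<open>K(0, g) = 0\<close>.
\<close>

lemma pairing_shift:
  assumes "f 0 = 0"
  shows "pairing (shift g xs) (translate g f) = \<alpha> g (pairing xs f)"
proof (induction xs)
  case Nil
  then show ?case by (simp add: shift_def action_simps)
next
  case (Cons x xs)
  obtain k b where x: "x = (k, b)" by (cases x)
  have "pairing (shift g (x # xs)) (translate g f) = star (\<alpha> g b) * (translate g f (g + k) - translate g f g)
      + pairing (shift g xs) (translate g f)"
    by (simp add: x shift_def algebra_simps star_minus)
  also have "translate g f (g + k) - translate g f g = \<alpha> g (f k)"
    using assms by (simp add: translate_def action_simps add.assoc[symmetric])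
  finally show ?case by (simp add: x Cons action_simps)
qed

lemma combination_at_zero: "combination xs 0 = 0"
  by (induction xs) auto

lemma gram_shift: "gram (shift g xs) (shift g ys) = \<alpha> g (gram xs ys)"
  by (simp add: gram_def combination_shift pairing_shift combination_at_zero)

lemma translate_diff: "translate g (\<lambda>s. f s - h s) = (\<lambda>s. translate g f s - translate g h s)"
  by (auto simp: translate_def action_simps)

lemma translate_tendsto:
  assumes "\<And>t. (\<lambda>n. F n t) \<longlonglongrightarrow> f t"
  shows "(\<lambda>n. translate g (F n) s) \<longlonglongrightarrow> translate g f s"
  unfolding translate_def
  by (intro cstar_automorphism_tendsto[OF automorphism] tendsto_diff assms)

lemmas translate_kernel_space =
  kernel_space_map[OF automorphism combination_shift gram_shift translate_diff translate_tendsto]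

lemmas kernel_inner_translate =
  kernel_inner_map[OF automorphism combination_shift gram_shift translate_diff translate_tendsto]

lemma kernel_space_at_zero:
  assumes "f \<in> kernel_space"
  shows "f 0 = 0"
proof -
  obtain X where X: "approximates X f" using assms by (auto simp: kernel_space_def)
  then have "(\<lambda>n. combination (X n) 0) \<longlonglongrightarrow> f 0" by (simp add: approximates_def)
  then show ?thesis by (simp add: combination_at_zero LIMSEQ_const_iff)
qed

lemma translate_add: "translate (g + h) f = translate g (translate h f)"
proof
  fix s
  have "- (g + h) + s = - h + (- g + s)" by (simp only: minus_add add.assoc)
  then show "translate (g + h) f s = translate g (translate h f) s"
    by (simp add: translate_def action_simps action_add minus_add)
qed

lemma translate_zero: "f \<in> kernel_space \<Longrightarrow> translate 0 f = f"
  by (auto simp: translate_def kernel_space_at_zero)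

text \<open>
  The maps for \<open>g\<close> and for \<open>- g\<close> are contractions and inverse to each other.
\<close>

lemma fnorm_translate:
  assumes "f \<in> kernel_space"
  shows "fnorm (translate g f) = fnorm f"
proof -
  have le: "fnorm (translate k h) \<le> fnorm h" if "h \<in> kernel_space" for h k
    using that by (simp add: fnorm_def kernel_inner_translate cstar_automorphism_norm_le[OF automorphism])
  have "fnorm (translate (- g) (translate g f)) \<le> fnorm (translate g f)"
    by (intro le translate_kernel_space assms)
  then show ?thesis
    using le[OF assms, of g] assms by (simp add: translate_zero flip: translate_add)
qed

lemma linear_isometric_bijection_translate:
  "linear_isometric_bijection kernel_module (translate g)"
  unfolding linear_isometric_bijection_def
proof (intro conjI)
  show "bij_betw (translate g) (carrier kernel_module) (carrier kernel_module)"
    by (rule bij_betw_byWitness[where f' = "translate (- g)"])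
      (auto simp: translate_zero translate_kernel_space simp flip: translate_add)
qed (auto simp: translate_def action_simps fnorm_translate algebra_simps scaleC_diff_right)

lemma equivariant_action_translate: "equivariant_action \<alpha> kernel_module translate"
  by (auto simp: equivariant_action_def linear_isometric_bijection_translate translate_add
      kernel_inner_translate) (auto simp: translate_def action_simps algebra_simps)

definition cocycle :: "'g \<Rightarrow> 'g \<Rightarrow> 'a" where
  "cocycle g = combination [(g, 1)]"

lemma kernel_inner_cocycle: "kernel_inner (cocycle g) (cocycle h) = K g h"
  by (simp add: cocycle_def kernel_inner_combination gram_def)

lemma one_cocycle_cocycle: "one_cocycle kernel_module translate cocycle"
proof -
  have "cocycle (g + h) s = cocycle g s + translate g (cocycle h) s" for g h s
    using K_translate[of s g h] by (simp add: cocycle_def translate_def algebra_simps)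
  then show ?thesis
    by (auto simp: one_cocycle_def cocycle_def combination_in_kernel_space)
qed

lemma K_central:
  assumes "\<And>g. \<psi> g \<in> algebra_center"
  shows "K g h \<in> algebra_center"
proof -
  have "\<alpha> g (\<psi> (- g + h)) \<in> algebra_center"
    by (rule cstar_automorphism_center[OF automorphism assms])
  then show ?thesis
    unfolding K_def by (intro center_scaleR center_diff center_add assms)
qed

end

theorem theorem3p17:
  fixes \<alpha> :: "'g::group_add \<Rightarrow> 'a::unital_cstar_algebra \<Rightarrow> 'a"
    and \<psi> :: "'g \<Rightarrow> 'a"
  assumes "cstar_action \<alpha>"
    and "\<And>g. \<psi> g \<in> positive_cone"
    and "negative_definite \<alpha> \<psi>"
    and "normalized \<psi>"
  shows "\<exists>(X :: ('a, 'g \<Rightarrow> 'a) hilbert_module) u c.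
    hilbert_module X \<and> equivariant_action \<alpha> X u \<and>
    one_cocycle X u c \<and> symmetric_cocycle X c \<and>
    (\<forall>g. \<psi> g = ip X (c g) (c g)) \<and>
    dense_in_module X (generated_submodule X (range c)) \<and>
    ((\<forall>g. \<psi> g \<in> algebra_center \<inter> positive_cone) \<longrightarrow> central_cocycle X c)"
proof -
  interpret negative_definite_function \<alpha> \<psi>
    using assms by unfold_locales
  have "symmetric_cocycle kernel_module cocycle"
    by (simp add: symmetric_cocycle_def kernel_inner_cocycle self_adjoint_def K_self_adjoint)
  moreover have "\<forall>g. \<psi> g = ip kernel_module (cocycle g) (cocycle g)"
    by (simp add: kernel_inner_cocycle K_diagonal)
  moreover have "dense_in_module kernel_module (generated_submodule kernel_module (range cocycle))"
    using generated_submodule_dense unfolding cocycle_def[abs_def] .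
  moreover have "central_cocycle kernel_module cocycle"
    if "\<forall>g. \<psi> g \<in> algebra_center \<inter> positive_cone"
  proof -
    have "\<psi> g \<in> algebra_center" for g using that by blast
    from K_central[OF this] show ?thesis
      by (simp add: central_cocycle_def kernel_inner_cocycle)
  qed
  ultimately show ?thesis
    using hilbert_module_kernel_module equivariant_action_translate one_cocycle_cocycle
    by (intro exI[of _ kernel_module] exI[of _ translate] exI[of _ cocycle] conjI impI)
qed

end
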